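(* Let $\alpha$ be the parameter of a family of very simple increasing trees, and let $D(\mathcal{T}_n)$ be the depth of the centroid (the one nearest to the root) in a random tree of size $n$ from this family. As $n\to\infty$, $D(\mathcal{T}_n)$ converges in distribution to a discrete random variable $\mathcal{D}$ supported on $\mathbb{Z}_{\ge 0}$; that is, $\lim_{n\to\infty}P_n(D=h)=P(\mathcal{D}=h)$ for every integer $h\ge 0$, where for all $h\ge 0$ $$P(\mathcal{D}\ge h)=\left(\frac{\alpha}{\alpha-1}\right)^h\left(1-2^{1-\alpha}\sum_{j=0}^{h-1}\frac{((\alpha-1)\ln 2)^j}{j!}\right)$$ and $$P(\mathcal{D}=h)=\frac{\alpha^h}{(\alpha-1)^{h+1}}\left[2^{1-\alpha}\left(\sum_{j=0}^{h-1}\frac{((\alpha-1)\ln 2)^j}{j!}+\frac{\alpha((\alpha-1)\ln 2)^h}{h!}\right)-1\right].$$ (For $\alpha=1$ the expressions on the right are to be read as their limits as $\alpha\to1$.)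
   Context: Random trees. An increasing tree of size $n$ is a rooted tree with $n$ nodes labelled $1,\dots,n$ such that labels increase along every path leading away from the root (so the root has label $1$). A family of very simple increasing trees is given by real constants $c_1>0$ and $c_2$; put $\alpha=1+c_2/c_1>0$. The admissible cases are: $c_2=0$, $\alpha=1$ (general recursive trees); $c_2<0$, $0<\alpha<1$ (general plane-oriented trees); $c_2>0$, $\alpha=d/(d-1)$ with an integer $d\ge2$ (general $d$-ary increasing trees). A plane (i.e. ordered) increasing tree $T$ has weight $\omega(T)=\prod_v\phi_{\mathrm{outdeg}(v)}$, where $\sum_i\phi_iu^i=\phi(u)$ with $\phi(u)=\exp(c_1u)$ if $c_2=0$ and $\phi(u)=(1+c_2u)^{1+c_1/c_2}$ otherwise; a random tree $\mathcal{T}_n$ of size $n$ is drawn with probability proportional to its weight. Equivalently (ignoring the order of children), the random tree is produced by the growth process which starts with the root $1$ and, for $i=2,\dots,n$, attaches node $i$ as a child to an existing node of current out-degree $k$ with probability $\frac{\alpha-(\alpha-1)k}{i+\alpha-2}$. $P_n$ denotes probability for a random tree of size $n$. Centroid. A centroid of a tree is a node minimising the sum of distances to all other nodes; equivalently, each branch at the node (maximal subtree not containing it) contains at most half of the nodes of the tree. Every tree has one centroid or two adjacent centroids; "the centroid" means the one nearest to the root. $D=D(T)$ is the number of edges on the path from the root to the centroid. *)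

theory Defs
  imports "HOL-Probability.Probability" "HOL-Computational_Algebra.Formal_Power_Series"
begin

datatype plane_tree = PNode (root_label: nat) (children: "plane_tree list")

fun nodes_list :: "plane_tree \<Rightarrow> nat list" where
  "nodes_list (PNode v ts) = v # concat (map nodes_list ts)"

definition nodes :: "plane_tree \<Rightarrow> nat set" where
  "nodes T = set (nodes_list T)"

fun is_increasing :: "plane_tree \<Rightarrow> bool" where
  "is_increasing (PNode v ts) \<longleftrightarrow> (\<forall>t\<in>set ts. v < root_label t \<and> is_increasing t)"

text \<open>Distinctness of \<^term>\<open>nodes_list T\<close> means that every label is used exactly once,
  so nodes may be identified with their labels.\<close>

definition increasing_trees :: "nat \<Rightarrow> plane_tree set" where
  "increasing_trees n =
     {T. is_increasing T \<and> distinct (nodes_list T) \<and> nodes T = {1..n}}"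

definition family_alpha :: "real \<Rightarrow> real \<Rightarrow> real" where
  "family_alpha c1 c2 = 1 + c2 / c1"

definition very_simple_family :: "real \<Rightarrow> real \<Rightarrow> bool" where
  "very_simple_family c1 c2 \<longleftrightarrow> c1 > 0 \<and>
     (c2 = 0 \<and> family_alpha c1 c2 = 1 \<or>
      c2 < 0 \<and> 0 < family_alpha c1 c2 \<and> family_alpha c1 c2 < 1 \<or>
      c2 > 0 \<and> (\<exists>d::nat. d \<ge> 2 \<and> family_alpha c1 c2 = real d / (real d - 1)))"

text \<open>The power series of \<open>exp (c1 u)\<close> if \<open>c2 = 0\<close>, and of \<open>(1 + c2 u) powr (1 + c1 / c2)\<close>
  otherwise: \<^term>\<open>fps_binomial a\<close> is the series of \<open>(1 + u) powr a\<close>.\<close>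

definition phi :: "real \<Rightarrow> real \<Rightarrow> real fps" where
  "phi c1 c2 = (if c2 = 0 then fps_exp c1
     else fps_compose (fps_binomial (1 + c1 / c2)) (fps_const c2 * fps_X))"

fun weight :: "real \<Rightarrow> real \<Rightarrow> plane_tree \<Rightarrow> real" where
  "weight c1 c2 (PNode v ts) =
     fps_nth (phi c1 c2) (length ts) * prod_list (map (weight c1 c2) ts)"

text \<open>For \<open>n = 0\<close> there is no tree and \<open>random_tree\<close> is an unspecified distribution.\<close>

definition random_tree :: "real \<Rightarrow> real \<Rightarrow> nat \<Rightarrow> plane_tree pmf" where
  "random_tree c1 c2 n = embed_pmf (\<lambda>T.
     if T \<in> increasing_trees n
     then weight c1 c2 T / (\<Sum>S\<in>increasing_trees n. weight c1 c2 S) else 0)"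

fun edges :: "plane_tree \<Rightarrow> (nat \<times> nat) set" where
  "edges (PNode v ts) = (\<Union>t\<in>set ts. insert (v, root_label t) (edges t))"

definition tree_dist :: "plane_tree \<Rightarrow> nat \<Rightarrow> nat \<Rightarrow> nat" where
  "tree_dist T u v = (LEAST k. (u, v) \<in> (edges T \<union> (edges T)\<inverse>) ^^ k)"

definition is_centroid :: "plane_tree \<Rightarrow> nat \<Rightarrow> bool" where
  "is_centroid T v \<longleftrightarrow> v \<in> nodes T \<and>
     (\<forall>w\<in>nodes T. (\<Sum>x\<in>nodes T. tree_dist T v x) \<le> (\<Sum>x\<in>nodes T. tree_dist T w x))"

text \<open>If there are two centroids they are adjacent, so the one nearest to the root is unique.\<close>

definition centroid :: "plane_tree \<Rightarrow> nat" where
  "centroid T = arg_min (tree_dist T (root_label T)) (is_centroid T)"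

definition centroid_depth :: "plane_tree \<Rightarrow> nat" where
  "centroid_depth T = tree_dist T (root_label T) (centroid T)"

definition depth_tail :: "real \<Rightarrow> nat \<Rightarrow> real" where
  "depth_tail \<alpha> h = (\<alpha> / (\<alpha> - 1)) ^ h *
     (1 - 2 powr (1 - \<alpha>) * (\<Sum>j<h. ((\<alpha> - 1) * ln 2) ^ j / fact j))"

definition depth_mass :: "real \<Rightarrow> nat \<Rightarrow> real" where
  "depth_mass \<alpha> h = \<alpha> ^ h / (\<alpha> - 1) ^ (h + 1) *
     (2 powr (1 - \<alpha>) *
        ((\<Sum>j<h. ((\<alpha> - 1) * ln 2) ^ j / fact j) + \<alpha> * ((\<alpha> - 1) * ln 2) ^ h / fact h) - 1)"

text \<open>The expressions above have a removable singularity at \<open>\<alpha> = 1\<close>, where only their limit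
  is meant.\<close>

definition equals_or_limit_at_1 :: "real \<Rightarrow> (real \<Rightarrow> real) \<Rightarrow> real \<Rightarrow> bool" where
  "equals_or_limit_at_1 p f \<alpha> \<longleftrightarrow> (if \<alpha> = 1 then (f \<longlongrightarrow> p) (at 1) else p = f \<alpha>)"

lemma finite_bounded_plane_trees:
  assumes "finite A"
  shows "finite {T. length (nodes_list T) \<le> n \<and> nodes T \<subseteq> A}"
proof (induction n)
  case 0
  have "length (nodes_list T) \<noteq> 0" for T by (cases T) auto
  then show ?case by auto
next
  case (Suc n)
  let ?S = "{T. length (nodes_list T) \<le> n \<and> nodes T \<subseteq> A}"
  have "T \<in> (\<lambda>(v, ts). PNode v ts) ` (A \<times> {ts. set ts \<subseteq> ?S \<and> length ts \<le> n})"
    if "length (nodes_list T) \<le> Suc n" "nodes T \<subseteq> A" for T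
  proof (cases T)
    case (PNode v ts)
    have pos: "1 \<le> length (nodes_list t)" for t by (cases t) auto
    have sum: "(\<Sum>t\<leftarrow>ts. length (nodes_list t)) \<le> n"
      using that PNode by (simp add: length_concat o_def)
    have "length ts \<le> (\<Sum>t\<leftarrow>ts. length (nodes_list t))"
      using sum_list_mono[of ts "\<lambda>_. 1::nat" "\<lambda>t. length (nodes_list t)"] pos
      by (simp add: sum_list_triv)
    moreover have "length (nodes_list t) \<le> n" if "t \<in> set ts" for t
      using member_le_sum_list[of "length (nodes_list t)" "map (\<lambda>t. length (nodes_list t)) ts"] that sum
      by auto
    ultimately show ?thesis
      using that PNode sum by (auto simp: nodes_def image_iff)
  qed
  then have "{T. length (nodes_list T) \<le> Suc n \<and> nodes T \<subseteq> A}
      \<subseteq> (\<lambda>(v, ts). PNode v ts) ` (A \<times> {ts. set ts \<subseteq> ?S \<and> length ts \<le> n})"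
    by blast
  moreover have "finite (A \<times> {ts. set ts \<subseteq> ?S \<and> length ts \<le> n})"
    using finite_lists_length_le[OF Suc] assms by simp
  ultimately show ?case
    by (meson finite_imageI finite_subset)
qed

lemma finite_increasing_trees: "finite (increasing_trees n)"
proof (rule finite_subset[OF _ finite_bounded_plane_trees[of "{1..n}" n]])
  show "increasing_trees n \<subseteq> {T. length (nodes_list T) \<le> n \<and> nodes T \<subseteq> {1..n}}"
    by (auto simp: increasing_trees_def nodes_def simp flip: distinct_card)
qed simp

lemma phi_0: "fps_nth (phi c1 c2) 0 = 1"
  by (simp add: phi_def)

lemma phi_Suc:
  "real (Suc k) * fps_nth (phi c1 c2) (Suc k) = (c1 + c2 - c2 * real k) * fps_nth (phi c1 c2) k"
proof (cases "c2 = 0")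
  case False
  have "real (Suc k) * ((1 + c1 / c2) gchoose Suc k) = (1 + c1 / c2 - real k) * ((1 + c1 / c2) gchoose k)"
    using gbinomial_mult_1[of "1 + c1 / c2" k] by (simp add: algebra_simps)
  then have "c2 ^ Suc k * (real (Suc k) * ((1 + c1 / c2) gchoose Suc k))
      = c2 ^ Suc k * ((1 + c1 / c2 - real k) * ((1 + c1 / c2) gchoose k))"
    by simp
  moreover have "c2 * (1 + c1 / c2 - real k) = c1 + c2 - c2 * real k"
    using False by (simp add: field_simps)
  then have "c2 ^ Suc k * ((1 + c1 / c2 - real k) * ((1 + c1 / c2) gchoose k))
      = (c1 + c2 - c2 * real k) * (c2 ^ k * ((1 + c1 / c2) gchoose k))"
    by (simp flip: mult.assoc)
  ultimately show ?thesis
    using False by (simp add: phi_def mult.left_commute del: power_Suc of_nat_Suc)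
next
  case True
  have "real (Suc k) * (c1 ^ Suc k / fact (Suc k)) = c1 * (c1 ^ k / fact k)"
    unfolding fact_Suc power_Suc by (simp del: of_nat_Suc of_nat_mult distrib_right)
  then show ?thesis
    using True by (simp add: phi_def del: of_nat_Suc power_Suc fact_Suc)
qed

lemma phi_nonneg:
  assumes "very_simple_family c1 c2"
  shows "fps_nth (phi c1 c2) k \<ge> 0"
proof -
  have c1: "c1 > 0" using assms by (simp add: very_simple_family_def)
  consider "c2 \<le> 0" "c1 + c2 > 0"
    | d :: nat where "d \<ge> 2" "c2 > 0" "c1 + c2 = c2 * real d"
  proof -
    have "c1 + c2 > 0" if "0 < family_alpha c1 c2"
      using that c1 by (simp add: family_alpha_def field_simps)
    moreover have "c1 + c2 = c2 * real d"
      if "d \<ge> 2" "family_alpha c1 c2 = real d / (real d - 1)" for d :: nat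
    proof -
      have "1 + c2 / c1 = 1 + 1 / (real d - 1)"
        using that by (simp add: family_alpha_def add_divide_eq_iff)
      then have "c2 / c1 = 1 / (real d - 1)" by linarith
      then have "c2 * (real d - 1) = c1" using c1 that(1) by (simp add: frac_eq_eq)
      then show ?thesis by (simp add: algebra_simps)
    qed
    ultimately show ?thesis
      using assms that c1 unfolding very_simple_family_def by force
  qed
  then show ?thesis
  proof cases
    case 1
    show ?thesis
    proof (induction k)
      case (Suc k)
      have "c1 + c2 - c2 * real k \<ge> 0"
        using 1 mult_nonpos_nonneg[of c2 "real k"] by linarith
      then have "real (Suc k) * fps_nth (phi c1 c2) (Suc k) \<ge> 0"
        unfolding phi_Suc using Suc by simp
      then show ?case by (simp add: zero_le_mult_iff)
    qed (simp add: phi_0)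
  next
    case 2
    have "fps_nth (phi c1 c2) k \<ge> 0 \<and> (k > d \<longrightarrow> fps_nth (phi c1 c2) k = 0)"
    proof (induction k)
      case (Suc k)
      have eq: "real (Suc k) * fps_nth (phi c1 c2) (Suc k) = c2 * (real d - real k) * fps_nth (phi c1 c2) k"
        unfolding phi_Suc 2(3) by (simp add: right_diff_distrib)
      show ?case
      proof (cases "k < d")
        case True
        then have "real (Suc k) * fps_nth (phi c1 c2) (Suc k) \<ge> 0"
          unfolding eq using Suc 2 by simp
        then show ?thesis using True by (simp add: zero_le_mult_iff)
      next
        case False
        then have "(real d - real k) * fps_nth (phi c1 c2) k = 0"
          using Suc by (cases "k = d") auto
        then have "real (Suc k) * fps_nth (phi c1 c2) (Suc k) = 0"
          unfolding eq by auto
        then show ?thesis by auto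
      qed
    qed (simp add: phi_0)
    then show ?thesis by simp
  qed
qed

lemma weight_nonneg:
  assumes "very_simple_family c1 c2"
  shows "weight c1 c2 T \<ge> 0"
proof (induction T)
  case (PNode v ts)
  then have "prod_list (map (weight c1 c2) ts) \<ge> 0"
    by (induction ts) auto
  then show ?case using phi_nonneg[OF assms] by simp
qed

lemma ex_weight_pos:
  assumes "very_simple_family c1 c2"
  shows "\<exists>T. root_label T = m \<and> is_increasing T \<and> distinct (nodes_list T) \<and> nodes T = {m..m + n} \<and>
    weight c1 c2 T > 0"
proof (induction n arbitrary: m)
  case 0
  show ?case by (intro exI[of _ "PNode m []"]) (simp add: nodes_def phi_0)
next
  case (Suc n)
  obtain T where T: "root_label T = Suc m" "is_increasing T" "distinct (nodes_list T)"
      "nodes T = {Suc m..Suc m + n}" "weight c1 c2 T > 0"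
    using Suc by blast
  have "c1 > 0" "c1 + c2 > 0"
    using assms by (auto simp: very_simple_family_def family_alpha_def field_simps)
  then have "fps_nth (phi c1 c2) (Suc 0) > 0"
    using phi_Suc[of 0 c1 c2] by (simp add: phi_0)
  moreover have "insert m {Suc m..Suc m + n} = {m..m + Suc n}" by auto
  ultimately show ?case
    using T by (intro exI[of _ "PNode m [T]"]) (auto simp: nodes_def)
qed

lemma sum_weight_pos:
  assumes "very_simple_family c1 c2" "n \<ge> 1"
  shows "(\<Sum>S\<in>increasing_trees n. weight c1 c2 S) > 0"
proof -
  obtain T where "is_increasing T" "distinct (nodes_list T)" "nodes T = {1..1 + (n - 1)}"
      "weight c1 c2 T > 0"
    using ex_weight_pos[OF assms(1), of 1 "n - 1"] by blast
  then show ?thesis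
    using assms by (intro sum_pos2[of _ T] finite_increasing_trees)
      (auto simp: increasing_trees_def weight_nonneg)
qed

lemma pmf_random_tree:
  assumes "very_simple_family c1 c2" "n \<ge> 1"
  shows "pmf (random_tree c1 c2 n) T =
    (if T \<in> increasing_trees n
     then weight c1 c2 T / (\<Sum>S\<in>increasing_trees n. weight c1 c2 S) else 0)"
  unfolding random_tree_def
proof (rule pmf_embed_pmf)
  let ?W = "\<Sum>S\<in>increasing_trees n. weight c1 c2 S"
  let ?f = "\<lambda>T. if T \<in> increasing_trees n then weight c1 c2 T / ?W else 0"
  have W: "?W > 0" by (rule sum_weight_pos[OF assms])
  show nonneg: "?f T \<ge> 0" for T
    using W weight_nonneg[OF assms(1)] by simp
  have "(\<integral>\<^sup>+T. ennreal (?f T) \<partial>count_space UNIV)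
      = (\<Sum>T\<in>increasing_trees n. ennreal (?f T))"
    by (rule nn_integral_count_space'[OF finite_increasing_trees]) auto
  also have "\<dots> = ennreal (\<Sum>T\<in>increasing_trees n. ?f T)"
    using nonneg by (intro sum_ennreal)
  also have "(\<Sum>T\<in>increasing_trees n. ?f T) = 1"
    using W by (simp flip: sum_divide_distrib)
  finally show "(\<integral>\<^sup>+T. ennreal (?f T) \<partial>count_space UNIV) = 1" by simp
qed

end

theory Submission
  imports Defs
begin

text \<open>Walk from the root towards the centroid: a step along an edge into a subtree of size \<open>s\<close> changes
the sum of distances by \<open>n - 2 s\<close>.  So the walk goes down exactly as long as some child carries more
than half of the nodes, and the centroid has depth at least \<open>h\<close> if and only if some node at depth
\<open>h\<close> carries a subtree of size greater than \<open>n div 2\<close>.  Two such subtrees at the same depth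
are disjoint and cannot both contain more than half of the nodes.  Hence \<open>P\<^sub>n (D \<ge> h)\<close> is the
expected number of subtrees of size greater than \<open>n div 2\<close> rooted at depth \<open>h\<close>
(\<open>large_subtrees_centroid_depth\<close>).

This expectation can be computed exactly, for every threshold \<open>M\<close>.  Every increasing tree of size
\<open>n + 1\<close> arises from a unique increasing tree of size \<open>n\<close> by attaching the leaf \<open>n + 1\<close>, and the
recurrence of the coefficients of \<open>phi\<close> says that a subtree of size \<open>m\<close> receives the leaf with
relative weight \<open>c1 m + c2\<close>.  The resulting linear recurrence in \<open>n\<close> is solved by
\<open>\<alpha>\<^sup>h / q(n)\<close> times the sum of \<open>q(k\<^sub>h) / (k\<^sub>1 \<cdots> k\<^sub>h)\<close> over all chains
\<open>M < k\<^sub>h < \<dots> < k\<^sub>1 < n\<close>, where \<open>q(n)\<close> is the product of \<open>1 + (\<alpha> - 1) / k\<close> over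
\<open>0 < k < n\<close> (\<open>total_large_subtrees_eq\<close>).  The chains are the possible sizes of the nested
subtrees on the way down from the root.  A tree of size \<open>n\<close> has \<open>\<alpha> q(k) / (k q(n))\<close> branches
of size \<open>k\<close> at its root on average, and in the product of these numbers along a chain all factors
\<open>q\<close> but two cancel.

Since \<open>q(k + 1) - q(k) = (\<alpha> - 1) q(k) / k\<close>, summation over the smallest index telescopes.  With
\<open>S\<^sub>h\<close> for the sum above and \<open>E\<^sub>h\<close> for the elementary symmetric polynomial of degree \<open>h\<close> in the numbers
\<open>1 / k\<close>, \<open>M < k < n\<close>, this gives \<open>(\<alpha> - 1) S\<^sub>h\<^sub>+\<^sub>1 = S\<^sub>h - q(M + 1) E\<^sub>h\<close>
(\<open>chain_sum_scaled_weight_Suc\<close>).  For \<open>M = n div 2\<close>, the polynomial \<open>E\<^sub>h\<close> differs little from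
the power \<open>E\<^sub>1\<^sup>h / h!\<close>, so it tends to \<open>(ln 2)\<^sup>h / h!\<close>, and \<open>q(M + 1) / q(n)\<close> tends to
\<open>2 powr (1 - \<alpha>)\<close>.  The recurrence for \<open>S\<^sub>h\<close> then becomes the recurrence satisfied by \<open>depth_tail\<close>.  For
\<open>\<alpha> = 1\<close> the factor \<open>q\<close> is constant and \<open>S\<^sub>h = E\<^sub>h\<close> directly.

Finally, \<open>depth_tail \<alpha> h\<close> is \<open>(\<alpha> / (\<alpha> - 1))\<^sup>h * 2 powr (1 - \<alpha>)\<close> times the remainder of a
Taylor polynomial of the exponential function, hence lies within a factor \<open>exp (\<plusminus> 2 \<bar>\<alpha> - 1\<bar> ln 2)\<close> of \<open>(\<alpha> ln 2)\<^sup>h / h!\<close>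
(\<open>depth_tail_bounds\<close>).  This identifies the limits at \<open>\<alpha> = 1\<close>, and shows that the tails tend to \<open>0\<close>
as \<open>h\<close> grows, so that no mass escapes and the limits are the tails of a probability distribution.\<close>

section \<open>Growth of increasing trees by one leaf\<close>

abbreviation tree_size :: "plane_tree \<Rightarrow> nat" where
  "tree_size T \<equiv> length (nodes_list T)"

text \<open>The number of subtrees rooted at depth \<open>h\<close> with more than \<open>M\<close> nodes, as a real number because it
is averaged with real weights below.\<close>

fun large_subtrees :: "nat \<Rightarrow> nat \<Rightarrow> plane_tree \<Rightarrow> real" where
  "large_subtrees M 0 T = of_bool (M < tree_size T)"
| "large_subtrees M (Suc h) (PNode v ts) = (\<Sum>t\<leftarrow>ts. large_subtrees M h t)"

text \<open>Attaching a leaf to a tree either adds a new child of the root, in one of several positions among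
its siblings, or changes exactly one of the children.  On lists of children these are the two
functions below.\<close>

fun insert_everywhere :: "'a \<Rightarrow> 'a list \<Rightarrow> 'a list list" where
  "insert_everywhere x [] = [[x]]"
| "insert_everywhere x (y # ys) = (x # y # ys) # map ((#) y) (insert_everywhere x ys)"

fun replace_one :: "('a \<Rightarrow> 'a list) \<Rightarrow> 'a list \<Rightarrow> 'a list list" where
  "replace_one f [] = []"
| "replace_one f (y # ys) = map (\<lambda>z. z # ys) (f y) @ map ((#) y) (replace_one f ys)"

lemma replace_one_cong [fundef_cong]:
  "xs = ys \<Longrightarrow> (\<And>y. y \<in> set ys \<Longrightarrow> f y = g y) \<Longrightarrow> replace_one f xs = replace_one g ys"
  by (induction ys arbitrary: xs) auto

text \<open>The trees are kept in a list: the weight of a tree of size \<open>n + 1\<close> has to be counted once for each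
place of the new leaf, and sums over lists follow the recursion.  That different places give
different trees is \<open>distinct_attach\<close>.\<close>

fun attach :: "nat \<Rightarrow> plane_tree \<Rightarrow> plane_tree list" where
  "attach x (PNode v ts) =
     map (PNode v) (insert_everywhere (PNode x []) ts @ replace_one (attach x) ts)"

text \<open>Removing the leaf labelled \<open>x\<close> inverts \<open>attach x\<close>; this is what makes the trees grown from
different trees different.\<close>

fun detach :: "nat \<Rightarrow> plane_tree \<Rightarrow> plane_tree" where
  "detach x (PNode v ts) = PNode v (map (detach x) (filter (\<lambda>t. root_label t \<noteq> x) ts))"

lemma length_insert_everywhere [simp]: "length (insert_everywhere x ys) = Suc (length ys)"
  by (induction ys) auto

lemma set_insert_everywhere:
  "us \<in> set (insert_everywhere x ys) \<longleftrightarrow> (\<exists>as bs. ys = as @ bs \<and> us = as @ x # bs)"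
proof (induction ys arbitrary: us)
  case (Cons y ys)
  show ?case
  proof
    assume "us \<in> set (insert_everywhere x (y # ys))"
    then consider "us = [] @ x # y # ys" | vs where "us = y # vs" "vs \<in> set (insert_everywhere x ys)"
      by auto
    then show "\<exists>as bs. y # ys = as @ bs \<and> us = as @ x # bs"
    proof cases
      case 2
      then obtain as bs where "ys = as @ bs" "vs = as @ x # bs" using Cons.IH by auto
      with 2 show ?thesis by (intro exI[of _ "y # as"] exI[of _ bs]) simp
    qed blast
  next
    assume "\<exists>as bs. y # ys = as @ bs \<and> us = as @ x # bs"
    then obtain as bs where *: "y # ys = as @ bs" "us = as @ x # bs" by blast
    show "us \<in> set (insert_everywhere x (y # ys))"
    proof (cases as)
      case (Cons a as')
      then have "as' @ x # bs \<in> set (insert_everywhere x ys)" using * Cons.IH by auto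
      then show ?thesis using * Cons by simp
    qed (use * in auto)
  qed
qed auto

lemma set_replace_one:
  "us \<in> set (replace_one f ys) \<longleftrightarrow>
     (\<exists>as y z bs. ys = as @ y # bs \<and> z \<in> set (f y) \<and> us = as @ z # bs)"
proof (induction ys arbitrary: us)
  case (Cons y ys)
  show ?case
  proof
    assume "us \<in> set (replace_one f (y # ys))"
    then consider z where "z \<in> set (f y)" "us = [] @ z # ys"
      | vs where "us = y # vs" "vs \<in> set (replace_one f ys)"
      by auto
    then show "\<exists>as y' z bs. y # ys = as @ y' # bs \<and> z \<in> set (f y') \<and> us = as @ z # bs"
    proof cases
      case 2
      then obtain as y' z bs where "ys = as @ y' # bs" "z \<in> set (f y')" "vs = as @ z # bs"
        using Cons.IH by auto
      with 2 show ?thesis by (intro exI[of _ "y # as"] exI[of _ y'] exI[of _ z] exI[of _ bs]) simp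
    qed (metis append_Nil)
  next
    assume "\<exists>as y' z bs. y # ys = as @ y' # bs \<and> z \<in> set (f y') \<and> us = as @ z # bs"
    then obtain as y' z bs where *: "y # ys = as @ y' # bs" "z \<in> set (f y')" "us = as @ z # bs"
      by blast
    show "us \<in> set (replace_one f (y # ys))"
    proof (cases as)
      case (Cons a as')
      then have "as' @ z # bs \<in> set (replace_one f ys)" using * Cons.IH by auto
      then show ?thesis using * Cons by simp
    qed (use * in auto)
  qed
qed auto

lemma distinct_insert_everywhere:
  "x \<notin> set ys \<Longrightarrow> distinct (insert_everywhere x ys)"
  by (induction ys) (auto simp: distinct_map)

lemma distinct_replace_one:
  assumes "\<And>y. y \<in> set ys \<Longrightarrow> distinct (f y)" "\<And>y. y \<in> set ys \<Longrightarrow> y \<notin> set (f y)"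
  shows "distinct (replace_one f ys)"
  using assms
proof (induction ys)
  case (Cons y ys)
  then show ?case
    by (auto simp: distinct_map inj_on_def)
qed auto

lemma mset_nodes_attach:
  "T' \<in> set (attach x T) \<Longrightarrow> mset (nodes_list T') = add_mset x (mset (nodes_list T))"
proof (induction x T arbitrary: T' rule: attach.induct)
  case (1 x v ts)
  then show ?case
    by (fastforce simp: set_insert_everywhere set_replace_one)
qed

lemma root_label_attach [simp]: "T' \<in> set (attach x T) \<Longrightarrow> root_label T' = root_label T"
  by (cases T) auto

lemma tree_size_attach: "T' \<in> set (attach x T) \<Longrightarrow> tree_size T' = Suc (tree_size T)"
  using mset_nodes_attach[of T' x T] by (metis size_add_mset size_mset)

lemma root_in_nodes [simp]: "root_label T \<in> nodes T"
  by (cases T) (auto simp: nodes_def)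

lemma nodes_PNode [simp]: "nodes (PNode v ts) = insert v (\<Union>t\<in>set ts. nodes t)"
  by (auto simp: nodes_def)

lemma root_label_less_node:
  "is_increasing T \<Longrightarrow> y \<in> nodes T \<Longrightarrow> y \<noteq> root_label T \<Longrightarrow> root_label T < y"
proof (induction T arbitrary: y rule: is_increasing.induct)
  case (1 v ts)
  then obtain t where t: "t \<in> set ts" "y \<in> nodes t" by auto
  with 1 have "v < root_label t" "root_label t \<le> y" by fastforce+
  then show ?case by simp
qed

lemma is_increasing_attach_iff:
  assumes "\<forall>y\<in>nodes T. y < x" "T' \<in> set (attach x T)"
  shows "is_increasing T' \<longleftrightarrow> is_increasing T"
  using assms
proof (induction x T arbitrary: T' rule: attach.induct)
  case (1 x v ts)
  have "T' \<in> PNode v ` set (insert_everywhere (PNode x []) ts) \<or> T' \<in> PNode v ` set (replace_one (attach x) ts)"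
    using 1 by auto
  then show ?case
  proof
    assume "T' \<in> PNode v ` set (insert_everywhere (PNode x []) ts)"
    then show ?case using 1(2) by (auto simp: set_insert_everywhere)
  next
    assume "T' \<in> PNode v ` set (replace_one (attach x) ts)"
    then obtain as t t' bs where *: "ts = as @ t # bs" "t' \<in> set (attach x t)" "T' = PNode v (as @ t' # bs)"
      by (auto simp: set_replace_one)
    then have "is_increasing t' = is_increasing t"
      using 1 by auto
    then show ?thesis using * by auto
  qed
qed

lemma detach_id: "x \<notin> nodes T \<Longrightarrow> detach x T = T"
proof (induction x T rule: detach.induct)
  case (1 x v ts)
  have "root_label t \<noteq> x" if "t \<in> set ts" for t
    using 1(2) that root_in_nodes[of t] by auto
  then have "filter (\<lambda>t. root_label t \<noteq> x) ts = ts" by (auto simp: filter_id_conv)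
  with 1 show ?case by (auto intro: map_idI)
qed

lemma detach_attach:
  assumes "x \<notin> nodes T" "T' \<in> set (attach x T)"
  shows "detach x T' = T"
  using assms
proof (induction x T arbitrary: T' rule: attach.induct)
  case (1 x v ts)
  have nx: "x \<notin> nodes t" if "t \<in> set ts" for t using 1(2) that by auto
  have keep: "map (detach x) (filter (\<lambda>t. root_label t \<noteq> x) us) = us" if "set us \<subseteq> set ts" for us
  proof -
    have "root_label t \<noteq> x" if "t \<in> set us" for t
      using nx[of t] root_in_nodes[of t] that \<open>set us \<subseteq> set ts\<close> by auto
    then have "filter (\<lambda>t. root_label t \<noteq> x) us = us" by (auto simp: filter_id_conv)
    then show ?thesis using nx that by (auto intro!: map_idI detach_id)
  qed
  have "T' \<in> PNode v ` set (insert_everywhere (PNode x []) ts) \<or> T' \<in> PNode v ` set (replace_one (attach x) ts)"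
    using 1 by auto
  then show ?case
  proof
    assume "T' \<in> PNode v ` set (insert_everywhere (PNode x []) ts)"
    then show ?case using keep by (auto simp: set_insert_everywhere)
  next
    assume "T' \<in> PNode v ` set (replace_one (attach x) ts)"
    then obtain as t t' bs where *: "ts = as @ t # bs" "t' \<in> set (attach x t)" "T' = PNode v (as @ t' # bs)"
      by (auto simp: set_replace_one)
    then have sub: "set as \<subseteq> set ts" "set bs \<subseteq> set ts" by auto
    have "detach x t' = t" using 1 * nx by auto
    moreover have "root_label t' \<noteq> x" using * nx[of t] root_in_nodes[of t] by auto
    ultimately show ?thesis using * keep[OF sub(1)] keep[OF sub(2)] by simp
  qed
qed

lemma attach_not_self: "T \<notin> set (attach x T)"
  using tree_size_attach[of T x T] by auto

lemma distinct_attach: "x \<notin> nodes T \<Longrightarrow> distinct (attach x T)"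
proof (induction x T rule: attach.induct)
  case (1 x v ts)
  have "PNode x [] \<notin> set ts" using 1(2) by (auto simp: nodes_def)
  moreover have "distinct (replace_one (attach x) ts)"
    using 1 attach_not_self by (intro distinct_replace_one) auto
  \<comment> \<open>The two kinds of insertion are told apart by the number of children of the root.\<close>
  moreover have "set (insert_everywhere (PNode x []) ts) \<inter> set (replace_one (attach x) ts) = {}"
    by (auto simp: set_insert_everywhere set_replace_one dest!: arg_cong[where f = length])
  ultimately show ?case
    by (auto simp: distinct_map inj_on_def distinct_insert_everywhere)
qed

text \<open>The node with the largest label has no children in an increasing tree, so it can be removed.\<close>

lemma is_increasing_attach_exists:
  assumes "is_increasing T'" "x \<in> nodes T'" "\<forall>y\<in>nodes T'. y \<le> x" "root_label T' \<noteq> x"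
  shows "\<exists>T. T' \<in> set (attach x T)"
  using assms
proof (induction T' rule: is_increasing.induct)
  case (1 v ts)
  then obtain t where t: "t \<in> set ts" "x \<in> nodes t" by auto
  then obtain as bs where ts: "ts = as @ t # bs" by (meson split_list)
  have inc: "is_increasing t" using 1 t by auto
  show ?case
  proof (cases "root_label t = x")
    case True
    have "children t = []"
    proof (rule ccontr)
      assume "children t \<noteq> []"
      then obtain s where "s \<in> set (children t)" by (cases "children t") auto
      moreover obtain us where "t = PNode x us" using True by (cases t) auto
      ultimately have "x < root_label s" "root_label s \<in> nodes t"
        using inc by (auto intro!: bexI[of _ s])
      then show False using 1(4) t by fastforce
    qed
    then have "t = PNode x []" using True by (cases t) auto
    then have "ts \<in> set (insert_everywhere (PNode x []) (as @ bs))"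
      using ts by (auto simp: set_insert_everywhere)
    then have "PNode v ts \<in> set (attach x (PNode v (as @ bs)))" by simp
    then show ?thesis ..
  next
    case False
    then obtain s where "t \<in> set (attach x s)"
      using 1 t inc by fastforce
    then have "ts \<in> set (replace_one (attach x) (as @ s # bs))"
      using ts by (auto simp: set_replace_one)
    then have "PNode v ts \<in> set (attach x (PNode v (as @ s # bs)))" by simp
    then show ?thesis ..
  qed
qed

lemma distinct_nodes_attach:
  assumes "T' \<in> set (attach x T)"
  shows "distinct (nodes_list T') \<longleftrightarrow> x \<notin> nodes T \<and> distinct (nodes_list T)"
  using mset_eq_imp_distinct_iff[of "nodes_list T'" "x # nodes_list T"] mset_nodes_attach[OF assms]
  by (simp add: nodes_def)

lemma nodes_attach:
  assumes "T' \<in> set (attach x T)"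
  shows "nodes T' = insert x (nodes T)"
  using mset_eq_setD[of "nodes_list T'" "x # nodes_list T"] mset_nodes_attach[OF assms]
  by (simp add: nodes_def)

lemma increasing_trees_Suc:
  assumes "n \<ge> 1"
  shows "increasing_trees (Suc n) = (\<Union>T\<in>increasing_trees n. set (attach (Suc n) T))"
proof (intro equalityI subsetI)
  fix T' assume T': "T' \<in> increasing_trees (Suc n)"
  then have inc: "is_increasing T'" "distinct (nodes_list T')" "nodes T' = {1..Suc n}"
    by (auto simp: increasing_trees_def)
  have "root_label T' \<noteq> Suc n"
  proof
    assume r: "root_label T' = Suc n"
    have "1 \<in> nodes T'" "1 \<noteq> Suc n" using assms inc(3) by auto
    then have "Suc n < 1" using root_label_less_node[OF inc(1), of 1] r by auto
    then show False by simp
  qed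
  then obtain T where T: "T' \<in> set (attach (Suc n) T)"
    using is_increasing_attach_exists[of T' "Suc n"] inc by auto
  have fresh: "distinct (nodes_list T)" "Suc n \<notin> nodes T"
    using inc(2) distinct_nodes_attach[OF T] by auto
  have "insert (Suc n) (nodes T) = {1..Suc n}"
    using inc(3) nodes_attach[OF T] by simp
  then have "nodes T = {1..Suc n} - {Suc n}" using fresh(2) by (metis Diff_insert_absorb)
  also have "\<dots> = {1..n}" by auto
  finally have nod: "nodes T = {1..n}" .
  moreover have "is_increasing T"
    using is_increasing_attach_iff[OF _ T] inc(1) nod by simp
  ultimately show "T' \<in> (\<Union>T\<in>increasing_trees n. set (attach (Suc n) T))"
    using T fresh(1) by (auto simp: increasing_trees_def)
next
  fix T' assume "T' \<in> (\<Union>T\<in>increasing_trees n. set (attach (Suc n) T))"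
  then obtain T where T: "T \<in> increasing_trees n" "T' \<in> set (attach (Suc n) T)" by auto
  have inc: "is_increasing T" "distinct (nodes_list T)" "nodes T = {1..n}"
    using T by (auto simp: increasing_trees_def)
  have "distinct (nodes_list T')"
    using distinct_nodes_attach[OF T(2)] inc by simp
  moreover have "nodes T' = {1..Suc n}"
    using nodes_attach[OF T(2)] inc(3) by (simp add: atLeastAtMostSuc_conv)
  moreover have "is_increasing T'"
    using is_increasing_attach_iff[OF _ T(2)] inc by simp
  ultimately show "T' \<in> increasing_trees (Suc n)" by (simp add: increasing_trees_def)
qed

text \<open>The growth process in weighted form: every sum over the trees of size \<open>n + 1\<close> can be organised
according to the tree that remains after the last node is removed.\<close>

lemma sum_increasing_trees_Suc:
  assumes "n \<ge> 1"
  shows "(\<Sum>T\<in>increasing_trees (Suc n). f T) = (\<Sum>T\<in>increasing_trees n. \<Sum>T'\<leftarrow>attach (Suc n) T. f T')"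
proof -
  have fresh: "Suc n \<notin> nodes T" if "T \<in> increasing_trees n" for T
    using that by (auto simp: increasing_trees_def)
  have "(\<Sum>T\<in>increasing_trees (Suc n). f T) = (\<Sum>T\<in>increasing_trees n. \<Sum>T'\<in>set (attach (Suc n) T). f T')"
    unfolding increasing_trees_Suc[OF assms]
  proof (rule sum.UNION_disjoint)
    show "\<forall>S\<in>increasing_trees n. \<forall>T\<in>increasing_trees n. S \<noteq> T \<longrightarrow>
        set (attach (Suc n) S) \<inter> set (attach (Suc n) T) = {}"
      using detach_attach fresh by blast
  qed (auto simp: finite_increasing_trees)
  also have "\<dots> = (\<Sum>T\<in>increasing_trees n. \<Sum>T'\<leftarrow>attach (Suc n) T. f T')"
    by (intro sum.cong refl sum_list_distinct_conv_sum_set[symmetric] distinct_attach fresh)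
  finally show ?thesis .
qed

section \<open>Weights under attachment of a leaf\<close>

lemma sum_list_insert_everywhere:
  fixes w H :: "'a \<Rightarrow> real"
  shows "(\<Sum>us\<leftarrow>insert_everywhere x ys. F (length us) * prod_list (map w us) * G (sum_list (map H us))) =
    real (Suc (length ys)) * F (Suc (length ys)) * w x * prod_list (map w ys) * G (H x + sum_list (map H ys))"
proof -
  have "(\<Sum>us\<leftarrow>insert_everywhere x ys. F (length us) * prod_list (map w us) * G (sum_list (map H us))) =
    (\<Sum>us\<leftarrow>insert_everywhere x ys. F (Suc (length ys)) * w x * prod_list (map w ys) * G (H x + sum_list (map H ys)))"
    by (intro arg_cong[where f = sum_list] map_cong refl)
       (auto simp: set_insert_everywhere ac_simps)
  also have "\<dots> = real (Suc (length ys)) * F (Suc (length ys)) * w x * prod_list (map w ys) * G (H x + sum_list (map H ys))"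
    by (simp add: sum_list_triv algebra_simps)
  finally show ?thesis .
qed

text \<open>A product rule.  If changing a single entry \<open>y\<close> multiplies its weight by \<open>b y\<close> in total, then changing
one entry of a list, whichever it is, multiplies the product of the weights by the sum of all \<open>b y\<close>.\<close>

lemma sum_list_replace_one_prod:
  fixes w b :: "'a \<Rightarrow> real"
  assumes "\<And>y. y \<in> set ys \<Longrightarrow> (\<Sum>z\<leftarrow>f y. w z) = w y * b y"
  shows "(\<Sum>us\<leftarrow>replace_one f ys. prod_list (map w us)) = prod_list (map w ys) * sum_list (map b ys)"
  using assms
proof (induction ys)
  case (Cons y ys)
  then show ?case
    by (simp add: o_def sum_list_const_mult sum_list_mult_const algebra_simps)
qed simp

text \<open>The product rule for a weighted additive statistic \<open>H\<close>, where \<open>d y\<close> is the expected increase of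
\<open>H y\<close>, multiplied by the total rate at which \<open>y\<close> changes.\<close>

lemma sum_list_replace_one_prod_sum:
  fixes w b H d :: "'a \<Rightarrow> real"
  assumes "\<And>y. y \<in> set ys \<Longrightarrow> (\<Sum>z\<leftarrow>f y. w z) = w y * b y"
    and "\<And>y. y \<in> set ys \<Longrightarrow> (\<Sum>z\<leftarrow>f y. w z * H z) = w y * (b y * H y + d y)"
  shows "(\<Sum>us\<leftarrow>replace_one f ys. prod_list (map w us) * sum_list (map H us)) =
    prod_list (map w ys) * (sum_list (map b ys) * sum_list (map H ys) + sum_list (map d ys))"
  using assms
proof (induction ys)
  case (Cons y ys)
  have replaced: "(\<Sum>z\<leftarrow>zs. w z * p * (H z + q)) = p * ((\<Sum>z\<leftarrow>zs. w z * H z) + q * (\<Sum>z\<leftarrow>zs. w z))"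
    for zs p q by (induction zs) (auto simp: algebra_simps)
  have attached: "(\<Sum>us\<leftarrow>uss. p * prod_list (map w us) * (q + sum_list (map H us))) =
      p * (q * (\<Sum>us\<leftarrow>uss. prod_list (map w us)) + (\<Sum>us\<leftarrow>uss. prod_list (map w us) * sum_list (map H us)))"
    for uss p q by (induction uss) (auto simp: algebra_simps)
  have "(\<Sum>us\<leftarrow>replace_one f ys. prod_list (map w us)) = prod_list (map w ys) * sum_list (map b ys)"
    using Cons.prems by (intro sum_list_replace_one_prod) auto
  moreover have "(\<Sum>us\<leftarrow>replace_one f (y # ys). prod_list (map w us) * sum_list (map H us)) =
      prod_list (map w ys) * ((\<Sum>z\<leftarrow>f y. w z * H z) + sum_list (map H ys) * (\<Sum>z\<leftarrow>f y. w z)) +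
      w y * (H y * (\<Sum>us\<leftarrow>replace_one f ys. prod_list (map w us)) +
        (\<Sum>us\<leftarrow>replace_one f ys. prod_list (map w us) * sum_list (map H us)))"
    unfolding replace_one.simps map_append sum_list_append map_map o_def prod_list.Cons
      sum_list.Cons list.map replaced attached ..
  moreover have "(\<Sum>us\<leftarrow>replace_one f ys. prod_list (map w us) * sum_list (map H us)) =
      prod_list (map w ys) * (sum_list (map b ys) * sum_list (map H ys) + sum_list (map d ys))"
    using Cons by auto
  moreover have "(\<Sum>z\<leftarrow>f y. w z) = w y * b y" "(\<Sum>z\<leftarrow>f y. w z * H z) = w y * (b y * H y + d y)"
    using Cons.prems by auto
  ultimately show ?case
    by (simp add: algebra_simps del: replace_one.simps)
qed simp

lemma sum_list_replace_one_length:
  fixes F :: "nat \<Rightarrow> real"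
  shows "(\<Sum>us\<leftarrow>replace_one f ys. F (length us) * G us) = F (length ys) * (\<Sum>us\<leftarrow>replace_one f ys. G us)"
proof -
  have "(\<Sum>us\<leftarrow>replace_one f ys. F (length us) * G us) = (\<Sum>us\<leftarrow>replace_one f ys. F (length ys) * G us)"
    by (intro arg_cong[where f = sum_list] map_cong refl) (auto simp: set_replace_one)
  then show ?thesis by (simp add: sum_list_const_mult)
qed

text \<open>Up to a common factor, the rate at which a tree of size \<open>n\<close> receives a new leaf.  By
\<open>sum_weight_attach\<close> it depends on the size of the tree only.\<close>

definition growth_rate :: "real \<Rightarrow> real \<Rightarrow> nat \<Rightarrow> real" where
  "growth_rate c1 c2 n = c1 * real n + c2"

text \<open>The root with \<open>k\<close> children itself attracts the leaf at rate \<open>c1 + c2 - c2 * k\<close>.  The term \<open>c2 * k\<close>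
cancels against the constant terms of the rates of the children, which is why the shape of the tree
disappears from the total.\<close>

lemma growth_rate_PNode:
  "growth_rate c1 c2 (tree_size (PNode v ts)) =
     (c1 + c2 - c2 * real (length ts)) + (\<Sum>t\<leftarrow>ts. growth_rate c1 c2 (tree_size t))"
proof -
  have "(\<Sum>t\<leftarrow>ts. growth_rate c1 c2 (tree_size t)) = c1 * real (\<Sum>t\<leftarrow>ts. tree_size t) + c2 * real (length ts)"
    by (induction ts) (auto simp: growth_rate_def algebra_simps)
  then show ?thesis
    by (simp add: growth_rate_def length_concat o_def algebra_simps)
qed

lemma sum_weight_attach:
  "(\<Sum>T'\<leftarrow>attach x T. weight c1 c2 T') = weight c1 c2 T * growth_rate c1 c2 (tree_size T)"
proof (induction T)
  case (PNode v ts)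
  let ?w = "weight c1 c2" and ?phi = "fps_nth (phi c1 c2)" and ?k = "length ts"
  let ?W = "prod_list (map ?w ts)"
  have "(\<Sum>T'\<leftarrow>attach x (PNode v ts). ?w T') =
      (\<Sum>us\<leftarrow>insert_everywhere (PNode x []) ts. ?phi (length us) * prod_list (map ?w us)) +
      (\<Sum>us\<leftarrow>replace_one (attach x) ts. ?phi (length us) * prod_list (map ?w us))"
    by (simp add: o_def)
  also have "\<dots> = real (Suc ?k) * ?phi (Suc ?k) * ?W +
      ?phi ?k * (?W * (\<Sum>t\<leftarrow>ts. growth_rate c1 c2 (tree_size t)))"
    using sum_list_insert_everywhere[where w = ?w and F = ?phi and G = "\<lambda>_. 1" and H = "\<lambda>_. 0" and
        x = "PNode x []" and ys = ts]
    by (simp add: sum_list_replace_one_length[where F = ?phi] phi_0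
        sum_list_replace_one_prod[where b = "\<lambda>t. growth_rate c1 c2 (tree_size t)", OF PNode.IH] del: of_nat_Suc)
  also have "\<dots> = ?w (PNode v ts) * growth_rate c1 c2 (tree_size (PNode v ts))"
    \<comment> \<open>A root with k children has k + 1 places for a new child, and (k + 1) phi (k + 1) is what
      the recurrence of the coefficients expresses through phi k.\<close>
    unfolding phi_Suc growth_rate_PNode by (simp add: algebra_simps)
  finally show ?case .
qed

text \<open>The increase of a statistic that is a sum over the children of the root: either the leaf becomes a new
child, or it enters one of the children.\<close>

lemma sum_weight_attach_additive:
  fixes H d :: "plane_tree \<Rightarrow> real"
  assumes "\<And>t. t \<in> set ts \<Longrightarrow> (\<Sum>t'\<leftarrow>attach x t. weight c1 c2 t' * H t') =
    weight c1 c2 t * (growth_rate c1 c2 (tree_size t) * H t + d t)"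
  shows "(\<Sum>T'\<leftarrow>attach x (PNode v ts). weight c1 c2 T' * (\<Sum>t\<leftarrow>children T'. H t)) =
    weight c1 c2 (PNode v ts) * (growth_rate c1 c2 (tree_size (PNode v ts)) * (\<Sum>t\<leftarrow>ts. H t) +
      ((c1 + c2 - c2 * real (length ts)) * H (PNode x []) + (\<Sum>t\<leftarrow>ts. d t)))"
proof -
  let ?w = "weight c1 c2" and ?phi = "fps_nth (phi c1 c2)" and ?k = "length ts"
  let ?W = "prod_list (map ?w ts)" and ?H = "\<lambda>us. sum_list (map H us)"
  have "(\<Sum>T'\<leftarrow>attach x (PNode v ts). ?w T' * ?H (children T')) =
      (\<Sum>us\<leftarrow>insert_everywhere (PNode x []) ts. ?phi (length us) * prod_list (map ?w us) * ?H us) +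
      (\<Sum>us\<leftarrow>replace_one (attach x) ts. ?phi (length us) * (prod_list (map ?w us) * ?H us))"
    by (simp add: o_def mult.assoc)
  also have "\<dots> = real (Suc ?k) * ?phi (Suc ?k) * ?W * (H (PNode x []) + ?H ts) +
      ?phi ?k * (?W * ((\<Sum>t\<leftarrow>ts. growth_rate c1 c2 (tree_size t)) * ?H ts + (\<Sum>t\<leftarrow>ts. d t)))"
    using sum_list_insert_everywhere[where w = ?w and F = ?phi and G = "\<lambda>s. s" and H = H and
        x = "PNode x []" and ys = ts]
    by (simp add: sum_list_replace_one_length[where F = ?phi] phi_0
        sum_list_replace_one_prod_sum[where b = "\<lambda>t. growth_rate c1 c2 (tree_size t)" and d = d,
          OF sum_weight_attach assms] del: of_nat_Suc)
  also have "\<dots> = ?w (PNode v ts) * (growth_rate c1 c2 (tree_size (PNode v ts)) * ?H ts +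
      ((c1 + c2 - c2 * real ?k) * H (PNode x []) + (\<Sum>t\<leftarrow>ts. d t)))"
    unfolding phi_Suc growth_rate_PNode by (simp add: algebra_simps)
  finally show ?thesis .
qed

lemma large_subtrees_Suc: "large_subtrees M (Suc h) T = (\<Sum>t\<leftarrow>children T. large_subtrees M h t)"
  by (cases T) simp

text \<open>The number of subtrees with more than \<open>M\<close> nodes grows exactly when the leaf enters one of the
subtrees with exactly \<open>M\<close> nodes.  The restriction \<open>M \<ge> 1\<close> excludes the subtree that consists of the new
leaf alone.\<close>

lemma sum_weight_large_subtrees_attach_pos:
  assumes "M \<ge> 1"
  shows "(\<Sum>T'\<leftarrow>attach x T. weight c1 c2 T' * large_subtrees M h T') =
    weight c1 c2 T * (growth_rate c1 c2 (tree_size T) * large_subtrees M h T +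
      growth_rate c1 c2 M * (large_subtrees (M - 1) h T - large_subtrees M h T))"
proof (induction h arbitrary: T)
  case 0
  have "(\<Sum>T'\<leftarrow>attach x T. weight c1 c2 T' * large_subtrees M 0 T') =
      (\<Sum>T'\<leftarrow>attach x T. weight c1 c2 T' * of_bool (M < Suc (tree_size T)))"
    by (intro arg_cong[where f = sum_list] map_cong refl) (auto dest: tree_size_attach)
  also have "\<dots> = weight c1 c2 T * growth_rate c1 c2 (tree_size T) * of_bool (M < Suc (tree_size T))"
    by (simp add: sum_list_mult_const sum_weight_attach)
  finally show ?case using assms by (auto simp: of_bool_def less_Suc_eq)
next
  case (Suc h)
  obtain v ts where T: "T = PNode v ts" by (cases T)
  have leaf: "large_subtrees M h (PNode x []) = 0" using assms by (cases h) auto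
  have "(\<Sum>t\<leftarrow>ts. growth_rate c1 c2 M * (large_subtrees (M - 1) h t - large_subtrees M h t)) =
      growth_rate c1 c2 M * (large_subtrees (M - 1) (Suc h) T - large_subtrees M (Suc h) T)"
    by (simp add: T sum_list_const_mult sum_list_subtractf)
  then show ?case
    unfolding large_subtrees_Suc
    using sum_weight_attach_additive[where H = "large_subtrees M h" and ts = ts and v = v, OF Suc.IH] leaf
    by (simp add: T del: weight.simps nodes_list.simps)
qed

text \<open>For \<open>M = 0\<close> all nodes at the given depth are counted, and their number grows when the leaf is
attached to a node one level higher.  The sum of \<open>c1 + c2 - c2 * k\<close> over the nodes at depth \<open>h\<close>, with
\<open>k\<close> their numbers of children, is expressed through the number of nodes at the two levels.\<close>

lemma sum_weight_large_subtrees_attach_0: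
  "(\<Sum>T'\<leftarrow>attach x T. weight c1 c2 T' * large_subtrees 0 (Suc h) T') =
    weight c1 c2 T * (growth_rate c1 c2 (tree_size T) * large_subtrees 0 (Suc h) T +
      ((c1 + c2) * large_subtrees 0 h T - c2 * large_subtrees 0 (Suc h) T))"
proof (induction h arbitrary: T)
  case 0
  obtain v ts where T: "T = PNode v ts" by (cases T)
  have ne: "nodes_list t \<noteq> []" for t by (cases t) auto
  have all: "large_subtrees 0 0 t = 1" for t using ne by simp
  have "(\<Sum>T'\<leftarrow>attach x T. weight c1 c2 T' * (\<Sum>t\<leftarrow>children T'. large_subtrees 0 0 t)) =
    weight c1 c2 T * (growth_rate c1 c2 (tree_size T) * (\<Sum>t\<leftarrow>ts. large_subtrees 0 0 t) +
      ((c1 + c2 - c2 * real (length ts)) * large_subtrees 0 0 (PNode x []) + (\<Sum>t\<leftarrow>ts. 0)))"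
    unfolding T by (rule sum_weight_attach_additive) (simp add: all sum_weight_attach del: large_subtrees.simps)
  then show ?case
    unfolding large_subtrees_Suc all by (simp add: T sum_list_triv algebra_simps del: weight.simps nodes_list.simps)
next
  case (Suc h)
  obtain v ts where T: "T = PNode v ts" by (cases T)
  have "(\<Sum>t\<leftarrow>ts. (c1 + c2) * large_subtrees 0 h t - c2 * large_subtrees 0 (Suc h) t) =
      (c1 + c2) * large_subtrees 0 (Suc h) T - c2 * large_subtrees 0 (Suc (Suc h)) T"
    by (simp add: T sum_list_const_mult sum_list_subtractf)
  then show ?case
    unfolding large_subtrees_Suc[of 0 "Suc h"]
    using sum_weight_attach_additive[where H = "large_subtrees 0 (Suc h)" and ts = ts and v = v, OF Suc.IH]
    by (simp add: T del: weight.simps nodes_list.simps)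
qed

definition total_weight :: "real \<Rightarrow> real \<Rightarrow> nat \<Rightarrow> real" where
  "total_weight c1 c2 n = (\<Sum>T\<in>increasing_trees n. weight c1 c2 T)"

definition total_large_subtrees :: "real \<Rightarrow> real \<Rightarrow> nat \<Rightarrow> nat \<Rightarrow> nat \<Rightarrow> real" where
  "total_large_subtrees c1 c2 M h n = (\<Sum>T\<in>increasing_trees n. weight c1 c2 T * large_subtrees M h T)"

lemma tree_size_increasing_trees: "T \<in> increasing_trees n \<Longrightarrow> tree_size T = n"
  by (auto simp: increasing_trees_def nodes_def simp flip: distinct_card)

lemma total_weight_Suc:
  assumes "n \<ge> 1"
  shows "total_weight c1 c2 (Suc n) = growth_rate c1 c2 n * total_weight c1 c2 n"
  unfolding total_weight_def sum_increasing_trees_Suc[OF assms] sum_weight_attach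
  by (simp add: tree_size_increasing_trees sum_distrib_left mult.commute)

lemma total_large_subtrees_Suc_pos:
  assumes "n \<ge> 1" "M \<ge> 1"
  shows "total_large_subtrees c1 c2 M h (Suc n) =
    growth_rate c1 c2 n * total_large_subtrees c1 c2 M h n +
    growth_rate c1 c2 M * (total_large_subtrees c1 c2 (M - 1) h n - total_large_subtrees c1 c2 M h n)"
  unfolding total_large_subtrees_def sum_increasing_trees_Suc[OF assms(1)]
    sum_weight_large_subtrees_attach_pos[OF assms(2)]
  by (simp add: tree_size_increasing_trees sum_distrib_left sum_subtractf sum.distrib algebra_simps)

lemma total_large_subtrees_Suc_0:
  assumes "n \<ge> 1"
  shows "total_large_subtrees c1 c2 0 (Suc h) (Suc n) =
    growth_rate c1 c2 n * total_large_subtrees c1 c2 0 (Suc h) n +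
    ((c1 + c2) * total_large_subtrees c1 c2 0 h n - c2 * total_large_subtrees c1 c2 0 (Suc h) n)"
  unfolding total_large_subtrees_def sum_increasing_trees_Suc[OF assms(1)]
    sum_weight_large_subtrees_attach_0
  by (simp add: tree_size_increasing_trees sum_distrib_left sum_subtractf sum.distrib algebra_simps
    del: large_subtrees.simps)

lemma increasing_trees_1: "increasing_trees 1 = {PNode 1 []}"
proof (intro equalityI subsetI)
  fix T assume T: "T \<in> increasing_trees 1"
  then have "tree_size T = 1" "nodes T = {1}"
    by (auto simp: tree_size_increasing_trees) (auto simp: increasing_trees_def)
  moreover have "nodes_list t \<noteq> []" for t by (cases t) auto
  ultimately show "T \<in> {PNode 1 []}" by (cases T; cases "children T") auto
qed (auto simp: increasing_trees_def)

section \<open>The expected number of large subtrees at a given depth\<close>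

text \<open>The total weight of the increasing trees of size \<open>n\<close>, divided by \<open>c1 ^ (n - 1) * fact (n - 1)\<close>, where
\<open>a\<close> is the parameter of the family.  It grows like a multiple of \<open>n powr (a - 1)\<close>.\<close>

definition scaled_weight :: "real \<Rightarrow> nat \<Rightarrow> real" where
  "scaled_weight a n = (\<Prod>k\<in>{0<..<n}. 1 + (a - 1) / real k)"

lemma scaled_weight_1 [simp]: "scaled_weight a (Suc 0) = 1"
proof -
  have "{0<..<Suc 0} = ({} :: nat set)" by auto
  then show ?thesis by (simp add: scaled_weight_def)
qed

lemma greaterThanLessThan_Suc: "M < n \<Longrightarrow> {M<..<Suc n} = insert n {M<..<n}" for M n :: nat
  by auto

lemma scaled_weight_Suc: "n \<ge> 1 \<Longrightarrow> scaled_weight a (Suc n) = (1 + (a - 1) / real n) * scaled_weight a n"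
  by (simp add: scaled_weight_def greaterThanLessThan_Suc)

lemma scaled_weight_pos: "a > 0 \<Longrightarrow> scaled_weight a n > 0"
  unfolding scaled_weight_def by (rule prod_pos) (auto simp: field_simps)

text \<open>The sum of \<open>f k\<^sub>h / (k\<^sub>1 \<cdots> k\<^sub>h)\<close> over all chains \<open>M < k\<^sub>h < \<dots> < k\<^sub>1 < n\<close>, where \<open>k\<^sub>0 = n\<close>.  For \<open>f = 1\<close> this is
the elementary symmetric polynomial of degree \<open>h\<close> in the numbers \<open>1 / k\<close>.  The empty chain counts
only if \<open>M < n\<close>, so that a tree with at most \<open>M\<close> nodes contributes nothing.\<close>

fun chain_sum :: "(nat \<Rightarrow> real) \<Rightarrow> nat \<Rightarrow> nat \<Rightarrow> nat \<Rightarrow> real" where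
  "chain_sum f M 0 n = (if M < n then f n else 0)"
| "chain_sum f M (Suc h) n = (\<Sum>k\<in>{M<..<n}. chain_sum f M h k / real k)"

lemma chain_sum_eq_0: "n \<le> M \<Longrightarrow> chain_sum f M h n = 0"
  by (cases h) (auto intro: sum.neutral)

lemma chain_sum_Suc_eq_0: "n \<le> Suc M \<Longrightarrow> chain_sum f M (Suc h) n = 0"
  by (auto intro: sum.neutral)

lemma chain_sum_Suc_Suc:
  "chain_sum f M (Suc h) (Suc n) = chain_sum f M (Suc h) n + chain_sum f M h n / real n"
proof (cases "M < n")
  case True
  then show ?thesis by (simp add: greaterThanLessThan_Suc)
next
  case False
  then show ?thesis by (simp add: chain_sum_eq_0 chain_sum_Suc_eq_0 del: chain_sum.simps)
qed

text \<open>For \<open>h = 0\<close> the identity is the telescoping sum of the differences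
\<open>q (k + 1) - q k = (a - 1) * q k / k\<close> of \<open>q = scaled_weight a\<close>.  Further summation over outer indices
preserves it, because it is linear.\<close>

lemma chain_sum_scaled_weight_Suc:
  "(a - 1) * chain_sum (scaled_weight a) M (Suc h) n =
     chain_sum (scaled_weight a) M h n - scaled_weight a (Suc M) * chain_sum (\<lambda>_. 1) M h n"
proof (induction h arbitrary: n)
  case 0
  show ?case
  proof (induction n)
    case (Suc n)
    show ?case
    proof (cases "M < n")
      case True
      then show ?thesis
        unfolding chain_sum_Suc_Suc distrib_left Suc using scaled_weight_Suc[of n a]
        by (simp add: algebra_simps)
    next
      case False
      then show ?thesis
        by (cases "n = M") (auto simp: chain_sum_eq_0 chain_sum_Suc_Suc simp del: chain_sum.simps(2))
    qed
  qed (simp add: chain_sum_eq_0)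
next
  case (Suc h)
  have "(a - 1) * chain_sum (scaled_weight a) M (Suc (Suc h)) n =
      (\<Sum>k\<in>{M<..<n}. ((a - 1) * chain_sum (scaled_weight a) M (Suc h) k) / real k)"
    unfolding chain_sum.simps(2)[of _ _ "Suc h"] by (simp add: sum_distrib_left del: chain_sum.simps)
  also have "\<dots> = (\<Sum>k\<in>{M<..<n}. chain_sum (scaled_weight a) M h k / real k -
      scaled_weight a (Suc M) * (chain_sum (\<lambda>_. 1) M h k / real k))"
    unfolding Suc by (simp add: diff_divide_distrib)
  also have "\<dots> = chain_sum (scaled_weight a) M (Suc h) n - scaled_weight a (Suc M) * chain_sum (\<lambda>_. 1) M (Suc h) n"
    by (simp add: sum_subtractf sum_distrib_left)
  finally show ?case .
qed

text \<open>The dependence on the threshold, again obtained from a telescoping sum for \<open>h = 0\<close> and by linearity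
for larger \<open>h\<close>.  This is the form in which the thresholds \<open>M\<close> and \<open>M + 1\<close> interact in the growth
process.\<close>

lemma chain_sum_scaled_weight_pred:
  "(a - 1) * chain_sum (scaled_weight a) M (Suc h) n +
     real (Suc M) * (chain_sum (scaled_weight a) M (Suc h) n - chain_sum (scaled_weight a) (Suc M) (Suc h) n) =
   chain_sum (scaled_weight a) (Suc M) h n"
proof (induction h arbitrary: n)
  case 0
  show ?case
  proof (cases "Suc M < n")
    case True
    then have "{M<..<n} = insert (Suc M) {Suc M<..<n}" by auto
    then have "chain_sum (scaled_weight a) M (Suc 0) n = chain_sum (scaled_weight a) (Suc M) (Suc 0) n + scaled_weight a (Suc M) / real (Suc M)"
      by simp
    then have "real (Suc M) * (chain_sum (scaled_weight a) M (Suc 0) n - chain_sum (scaled_weight a) (Suc M) (Suc 0) n) = scaled_weight a (Suc M)"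
      by (simp del: chain_sum.simps)
    with True show ?thesis unfolding chain_sum_scaled_weight_Suc by simp
  next
    case False
    then show ?thesis by (simp add: chain_sum_eq_0 chain_sum_Suc_eq_0 del: chain_sum.simps)
  qed
next
  case (Suc h)
  \<comment> \<open>The term at the index M + 1 vanishes, as there is no chain strictly between M and M + 1.\<close>
  have restrict: "chain_sum (scaled_weight a) M (Suc (Suc h)) n = (\<Sum>k\<in>{Suc M<..<n}. chain_sum (scaled_weight a) M (Suc h) k / real k)"
    unfolding chain_sum.simps(2)[of _ _ "Suc h"]
  proof (rule sum.mono_neutral_right)
    show "\<forall>k\<in>{M<..<n} - {Suc M<..<n}. chain_sum (scaled_weight a) M (Suc h) k / real k = 0"
      by (auto simp: chain_sum_Suc_eq_0 simp del: chain_sum.simps)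
  qed auto
  have "(a - 1) * chain_sum (scaled_weight a) M (Suc (Suc h)) n +
      real (Suc M) * (chain_sum (scaled_weight a) M (Suc (Suc h)) n - chain_sum (scaled_weight a) (Suc M) (Suc (Suc h)) n) =
    (\<Sum>k\<in>{Suc M<..<n}. ((a - 1) * chain_sum (scaled_weight a) M (Suc h) k +
      real (Suc M) * (chain_sum (scaled_weight a) M (Suc h) k - chain_sum (scaled_weight a) (Suc M) (Suc h) k)) / real k)"
    unfolding restrict chain_sum.simps(2)[of _ "Suc M" "Suc h"]
    by (simp only: add_divide_distrib sum.distrib sum_distrib_left diff_divide_distrib right_diff_distrib
        sum_subtractf times_divide_eq_right)
  also have "\<dots> = chain_sum (scaled_weight a) (Suc M) (Suc h) n"
    unfolding Suc by simp
  finally show ?case .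
qed

text \<open>The recurrence of the growth process, in terms of chain sums.\<close>

lemma chain_sum_scaled_weight_growth:
  assumes "n \<ge> 1" "M \<ge> 1"
  shows "real n * chain_sum (scaled_weight a) M h (Suc n) =
    (real n + a - 1) * chain_sum (scaled_weight a) M h n +
    (real M + a - 1) * (chain_sum (scaled_weight a) (M - 1) h n - chain_sum (scaled_weight a) M h n)"
proof (cases h)
  case 0
  have "real n * scaled_weight a (Suc n) = (real n + a - 1) * scaled_weight a n"
    using assms scaled_weight_Suc[of n a] by (simp add: field_simps)
  then show ?thesis using 0 assms by (cases "n < M"; cases "n = M") auto
next
  case (Suc j)
  obtain m where m: "M = Suc m" using assms by (cases M) auto
  have "real n * chain_sum (scaled_weight a) M (Suc j) (Suc n) = real n * chain_sum (scaled_weight a) M (Suc j) n + chain_sum (scaled_weight a) M j n"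
    unfolding chain_sum_Suc_Suc using assms by (simp add: distrib_left del: chain_sum.simps)
  also have "\<dots> = real n * chain_sum (scaled_weight a) M (Suc j) n + ((a - 1) * chain_sum (scaled_weight a) m (Suc j) n +
     real (Suc m) * (chain_sum (scaled_weight a) m (Suc j) n - chain_sum (scaled_weight a) M (Suc j) n))"
    unfolding chain_sum_scaled_weight_pred m ..
  also have "\<dots> = (real n + a - 1) * chain_sum (scaled_weight a) M (Suc j) n +
    (real M + a - 1) * (chain_sum (scaled_weight a) (M - 1) (Suc j) n - chain_sum (scaled_weight a) M (Suc j) n)"
    unfolding m by (simp add: algebra_simps del: chain_sum.simps)
  finally show ?thesis using Suc by simp
qed

lemma growth_rate_family_alpha:
  assumes "c1 > 0"
  shows "growth_rate c1 c2 n = c1 * (real n + family_alpha c1 c2 - 1)"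
  using assms by (simp add: growth_rate_def family_alpha_def field_simps)

lemma large_subtrees_0_0 [simp]: "large_subtrees 0 0 T = 1"
  by (cases T) simp

text \<open>The exact expected number of large subtrees.  Both sides satisfy the recurrence that comes from
attaching the next leaf; the induction on \<open>n\<close> treats all depths and thresholds at once, since the
recurrence relates neighbouring ones.\<close>

lemma total_large_subtrees_eq:
  fixes c1 c2 :: real
  assumes "c1 > 0" "n \<ge> 1"
  defines "a \<equiv> family_alpha c1 c2"
  shows "total_large_subtrees c1 c2 M h n * scaled_weight a n = total_weight c1 c2 n * a ^ h * chain_sum (scaled_weight a) M h n"
  using assms(2)
proof (induction n arbitrary: M h rule: nat_induct_at_least)
  case base
  have "large_subtrees M h (PNode 1 []) = chain_sum (scaled_weight a) M h 1"
    by (cases h) (auto intro!: sum.neutral[symmetric])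
  then show ?case
    unfolding total_large_subtrees_def total_weight_def increasing_trees_1
    by (cases h) (auto simp: phi_0)
next
  case (Suc n)
  have n: "real n > 0" using Suc(1) by simp
  have c: "c1 + c2 = c1 * a" using assms(1) by (simp add: a_def family_alpha_def field_simps)
  have step: "scaled_weight a (Suc n) = (real n + a - 1) / real n * scaled_weight a n"
    using scaled_weight_Suc[of n a] Suc n by (simp add: field_simps)
  have W: "total_weight c1 c2 (Suc n) = c1 * (real n + a - 1) * total_weight c1 c2 n"
    using total_weight_Suc[OF Suc(1)] growth_rate_family_alpha[OF assms(1)] by (simp add: a_def)
  consider "M \<ge> 1" | "M = 0" "h = 0" | j where "M = 0" "h = Suc j" by (cases M; cases h) auto
  then show ?case
  proof cases
    case 1
    let ?A = "total_large_subtrees c1 c2" and ?C = "chain_sum (scaled_weight a)" and ?W = "total_weight c1 c2 n"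
    have "?A M h (Suc n) * scaled_weight a (Suc n) = c1 * (real n + a - 1) / real n *
        ((real n + a - 1) * (?A M h n * scaled_weight a n) +
         (real M + a - 1) * (?A (M - 1) h n * scaled_weight a n - ?A M h n * scaled_weight a n))"
      unfolding total_large_subtrees_Suc_pos[OF Suc(1) 1] growth_rate_family_alpha[OF assms(1)] step
        a_def[symmetric] by (simp add: field_simps)
    also have "\<dots> = c1 * (real n + a - 1) / real n * ?W * a ^ h *
        ((real n + a - 1) * ?C M h n + (real M + a - 1) * (?C (M - 1) h n - ?C M h n))"
      unfolding Suc.IH by (simp add: field_simps del: chain_sum.simps)
    also have "\<dots> = c1 * (real n + a - 1) / real n * ?W * a ^ h * (real n * ?C M h (Suc n))"
      unfolding chain_sum_scaled_weight_growth[OF Suc(1) 1] ..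
    finally show ?thesis using n unfolding W by simp
  next
    case 2
    then show ?thesis
      by (simp add: total_large_subtrees_def total_weight_def del: large_subtrees.simps)
  next
    case 3
    let ?A = "total_large_subtrees c1 c2 0" and ?C = "chain_sum (scaled_weight a) 0" and ?W = "total_weight c1 c2 n"
    have "growth_rate c1 c2 n - c2 = c1 * real n" by (simp add: growth_rate_def)
    then have "?A (Suc j) (Suc n) = c1 * (real n * ?A (Suc j) n + a * ?A j n)"
      unfolding total_large_subtrees_Suc_0[OF Suc(1)] c by (simp add: algebra_simps flip: left_diff_distrib)
    then have "?A (Suc j) (Suc n) * scaled_weight a (Suc n) = c1 * (real n + a - 1) / real n *
        (real n * (?A (Suc j) n * scaled_weight a n) + a * (?A j n * scaled_weight a n))"
      unfolding step by (simp add: field_simps)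
    also have "\<dots> = c1 * (real n + a - 1) * ?W * a ^ Suc j * (?C (Suc j) n + ?C j n / real n)"
      unfolding Suc.IH using n by (simp add: field_simps del: chain_sum.simps)
    finally show ?thesis unfolding 3 W chain_sum_Suc_Suc .
  qed
qed

section \<open>The centroid and the large subtrees\<close>

text \<open>Subtrees are described from the top of the fixed tree \<open>T\<close>, because the distances that have to be
compared are distances in \<open>T\<close>.\<close>

inductive subtree_at :: "plane_tree \<Rightarrow> nat \<Rightarrow> plane_tree \<Rightarrow> bool" for T where
  root: "subtree_at T 0 T"
| child: "subtree_at T h (PNode v ts) \<Longrightarrow> t \<in> set ts \<Longrightarrow> subtree_at T (Suc h) t"

abbreviation undirected_edges :: "plane_tree \<Rightarrow> (nat \<times> nat) set" where
  "undirected_edges T \<equiv> edges T \<union> (edges T)\<inverse>"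

lemma edges_subset_nodes: "edges T \<subseteq> nodes T \<times> nodes T"
  by (induction T rule: edges.induct) fastforce

lemma child_eq_if_common_node:
  assumes "distinct (nodes_list (PNode v ts))" "s \<in> set ts" "t \<in> set ts" "x \<in> nodes s" "x \<in> nodes t"
  shows "s = t"
proof -
  have "distinct (concat (map nodes_list ts))" using assms(1) by simp
  then show ?thesis using assms(2-) by (induction ts) (auto simp: nodes_def)
qed

lemma distinct_nodes_child:
  assumes "distinct (nodes_list (PNode v ts))" "t \<in> set ts"
  shows "distinct (nodes_list t)" "v \<notin> nodes t"
proof -
  have "distinct (concat (map nodes_list ts))" using assms(1) by simp
  then show "distinct (nodes_list t)" using assms(2) by (induction ts) auto
  show "v \<notin> nodes t" using assms by (auto simp: nodes_def)
qed

lemma distinct_nodes_subtree: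
  "subtree_at T h s \<Longrightarrow> distinct (nodes_list T) \<Longrightarrow> distinct (nodes_list s)"
  by (induction rule: subtree_at.induct) (auto intro: distinct_nodes_child)

lemma nodes_subtree: "subtree_at T h s \<Longrightarrow> nodes s \<subseteq> nodes T"
  by (induction rule: subtree_at.induct) auto

text \<open>The only edge of \<open>T\<close> between a subtree and the remaining nodes is the one from its root to the parent
of its root.\<close>

lemma edges_touching_subtree:
  assumes "subtree_at T h s" "distinct (nodes_list T)" "(a, b) \<in> edges T"
  shows "(a \<in> nodes s \<longrightarrow> (a, b) \<in> edges s) \<and> (b \<in> nodes s \<longrightarrow> b = root_label s \<or> (a, b) \<in> edges s)"
  using assms
proof (induction rule: subtree_at.induct)
  case (child h v ts t)
  note d = distinct_nodes_subtree[OF child.hyps(1) child.prems(1)]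
  have v: "v \<notin> nodes t" using distinct_nodes_child[OF d child.hyps(2)] by simp
  have inside: "(a, b) = (v, root_label t) \<or> (a, b) \<in> edges t"
    if e: "(a, b) \<in> edges (PNode v ts)" and ab: "a \<in> nodes t \<or> b \<in> nodes t"
  proof -
    obtain t' where t': "t' \<in> set ts" "(a, b) = (v, root_label t') \<or> (a, b) \<in> edges t'"
      using e unfolding edges.simps by blast
    have "t' = t"
      using t' ab v edges_subset_nodes[of t'] child_eq_if_common_node[OF d t'(1) child.hyps(2)]
        root_in_nodes[of t'] by blast
    with t' show ?thesis by simp
  qed
  show ?case
    using child.IH[OF child.prems] inside child.hyps(2) v by auto
qed simp

text \<open>Removing the edge between \<open>v\<close> and its child separates the nodes below the child from all others.\<close>

lemma edge_leaving_subtree: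
  assumes "subtree_at T h (PNode v ts)" "t \<in> set ts" "distinct (nodes_list T)"
    and "(a, b) \<in> undirected_edges T"
  shows "a \<notin> nodes t \<Longrightarrow> b \<in> nodes t \<Longrightarrow> a = v \<and> b = root_label t"
    and "a \<in> nodes t \<Longrightarrow> b \<notin> nodes t \<Longrightarrow> a = root_label t \<and> b = v"
proof -
  note t = child[OF assms(1,2)]
  note d = distinct_nodes_subtree[OF assms(1,3)]
  have v: "v \<notin> nodes t" using distinct_nodes_child[OF d assms(2)] by simp
  have out: "y \<in> nodes t" if "(x, y) \<in> edges T" "x \<in> nodes t" for x y
    using edges_touching_subtree[OF t assms(3) that(1)] that(2) edges_subset_nodes by blast
  have into: "x = v \<and> y = root_label t" if "(x, y) \<in> edges T" "x \<notin> nodes t" "y \<in> nodes t" for x y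
  proof -
    have "y \<in> nodes (PNode v ts)" "y \<noteq> v" using that(3) assms(2) v by auto
    then have "(x, y) \<in> edges (PNode v ts)"
      using edges_touching_subtree[OF assms(1,3) that(1)] by auto
    then obtain t' where t': "t' \<in> set ts" "(x, y) = (v, root_label t') \<or> (x, y) \<in> edges t'"
      unfolding edges.simps by blast
    then have "y \<in> nodes t'" using edges_subset_nodes[of t'] root_in_nodes[of t'] by blast
    then have "t' = t" using child_eq_if_common_node[OF d t'(1) assms(2)] that(3) by simp
    then show ?thesis using t'(2) that(2) edges_subset_nodes[of t] by blast
  qed
  show "a \<notin> nodes t \<Longrightarrow> b \<in> nodes t \<Longrightarrow> a = v \<and> b = root_label t"
    "a \<in> nodes t \<Longrightarrow> b \<notin> nodes t \<Longrightarrow> a = root_label t \<and> b = v"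
    using assms(4) out into by blast+
qed

lemma root_reaches_nodes: "x \<in> nodes T \<Longrightarrow> (root_label T, x) \<in> (edges T)\<^sup>*"
proof (induction T)
  case (PNode v ts)
  show ?case
  proof (cases "x = v")
    case False
    then obtain t where t: "t \<in> set ts" "x \<in> nodes t" using PNode.prems by auto
    then have "(root_label t, x) \<in> (edges t)\<^sup>*" using PNode.IH by simp
    moreover have "(edges t)\<^sup>* \<subseteq> (edges (PNode v ts))\<^sup>*"
      using t(1) by (intro rtrancl_mono) auto
    moreover have "(v, root_label t) \<in> edges (PNode v ts)" using t(1) by auto
    ultimately show ?thesis by (auto intro: converse_rtrancl_into_rtrancl)
  qed simp
qed

lemma tree_dist_path:
  assumes "x \<in> nodes T" "y \<in> nodes T"
  shows "(x, y) \<in> undirected_edges T ^^ tree_dist T x y"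
proof -
  have sym: "sym ((undirected_edges T)\<^sup>*)" by (intro sym_rtrancl symI) auto
  have reach: "(root_label T, z) \<in> (undirected_edges T)\<^sup>*" if "z \<in> nodes T" for z
    using root_reaches_nodes[OF that] rtrancl_mono[of "edges T" "undirected_edges T"] by auto
  have "(x, y) \<in> (undirected_edges T)\<^sup>*"
    using symD[OF sym reach[OF assms(1)]] reach[OF assms(2)] by (rule rtrancl_trans)
  then have "\<exists>k. (x, y) \<in> undirected_edges T ^^ k" by (simp add: rtrancl_is_UN_relpow)
  then show ?thesis unfolding tree_dist_def by (rule LeastI_ex)
qed

lemma tree_dist_le: "(x, y) \<in> undirected_edges T ^^ k \<Longrightarrow> tree_dist T x y \<le> k"
  unfolding tree_dist_def by (rule Least_le)

lemma undirected_path_sym: "(x, y) \<in> undirected_edges T ^^ k \<Longrightarrow> (y, x) \<in> undirected_edges T ^^ k"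
proof (induction k arbitrary: y)
  case (Suc k)
  then obtain z where "(x, z) \<in> undirected_edges T ^^ k" "(z, y) \<in> undirected_edges T" by auto
  then have "(z, x) \<in> undirected_edges T ^^ k" "(y, z) \<in> undirected_edges T" using Suc.IH by auto
  then show ?case by (rule relpow_Suc_I2[rotated])
qed simp

lemma tree_dist_sym: "tree_dist T x y = tree_dist T y x"
  unfolding tree_dist_def by (metis undirected_path_sym)

lemma tree_dist_same [simp]: "tree_dist T x x = 0"
  using tree_dist_le[of x x 0 T] by simp

lemma path_enters:
  assumes "(a, b) \<in> R ^^ k" "a \<notin> S" "b \<in> S"
    and "\<And>p q. (p, q) \<in> R \<Longrightarrow> p \<notin> S \<Longrightarrow> q \<in> S \<Longrightarrow> q = w"
  shows "\<exists>j<k. (w, b) \<in> R ^^ j"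
  using assms(1,2)
proof (induction k arbitrary: a)
  case (Suc k)
  then obtain c where c: "(a, c) \<in> R" "(c, b) \<in> R ^^ k" by (meson relpow_Suc_D2)
  show ?case
  proof (cases "c \<in> S")
    case True
    then have "c = w" using assms(4) c(1) Suc.prems(2) by blast
    then show ?thesis using c(2) by auto
  next
    case False
    then show ?thesis using Suc.IH[OF c(2)] less_Suc_eq by blast
  qed
qed (use assms(3) in auto)

text \<open>A shortest path that ends in \<open>S\<close> and starts outside has to use the edge by which \<open>S\<close> can be
entered.\<close>

lemma tree_dist_through_edge:
  assumes "(v, w) \<in> undirected_edges T" "v \<notin> S" "x \<in> S" "v \<in> nodes T" "w \<in> nodes T" "x \<in> nodes T"
    and "\<And>p q. (p, q) \<in> undirected_edges T \<Longrightarrow> p \<notin> S \<Longrightarrow> q \<in> S \<Longrightarrow> q = w"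
  shows "tree_dist T v x = Suc (tree_dist T w x)"
proof (rule antisym)
  have "(v, x) \<in> undirected_edges T ^^ Suc (tree_dist T w x)"
    using assms(1) tree_dist_path[OF assms(5,6)] by (rule relpow_Suc_I2)
  then show "tree_dist T v x \<le> Suc (tree_dist T w x)" by (rule tree_dist_le)
  obtain j where "j < tree_dist T v x" "(w, x) \<in> undirected_edges T ^^ j"
    using path_enters[where w = w, OF tree_dist_path[OF assms(4,6)] assms(2,3)] assms(7) by blast
  then show "Suc (tree_dist T w x) \<le> tree_dist T v x"
    using tree_dist_le[of w x j T] by simp
qed

lemma edges_subtree: "subtree_at T h s \<Longrightarrow> edges s \<subseteq> edges T"
proof (induction rule: subtree_at.induct)
  case (child h v ts t)
  have "edges t \<subseteq> edges (PNode v ts)" using child.hyps(2) by auto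
  then show ?case using child.IH by blast
qed simp

lemma tree_dist_child:
  assumes "subtree_at T h (PNode v ts)" "t \<in> set ts" "distinct (nodes_list T)" "x \<in> nodes T"
  shows "x \<in> nodes t \<Longrightarrow> tree_dist T v x = Suc (tree_dist T (root_label t) x)"
    and "x \<notin> nodes t \<Longrightarrow> tree_dist T (root_label t) x = Suc (tree_dist T v x)"
proof -
  note cut = edge_leaving_subtree[OF assms(1-3)]
  have v: "v \<notin> nodes t"
    using distinct_nodes_child[OF distinct_nodes_subtree[OF assms(1,3)] assms(2)] by simp
  have mem: "v \<in> nodes T" "root_label t \<in> nodes T"
    using nodes_subtree[OF assms(1)] nodes_subtree[OF child[OF assms(1,2)]] by auto
  have "(v, root_label t) \<in> edges T"
    using edges_subtree[OF assms(1)] assms(2) by auto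
  then have e: "(v, root_label t) \<in> undirected_edges T" "(root_label t, v) \<in> undirected_edges T"
    by auto
  show "tree_dist T v x = Suc (tree_dist T (root_label t) x)" if "x \<in> nodes t"
    using cut(1) by (intro tree_dist_through_edge[OF e(1) v that mem assms(4)]) simp
  show "tree_dist T (root_label t) x = Suc (tree_dist T v x)" if "x \<notin> nodes t"
    using cut(2) that by (intro tree_dist_through_edge[OF e(2) _ _ mem(2,1) assms(4), where S = "- nodes t"]) auto
qed

definition distance_sum :: "plane_tree \<Rightarrow> nat \<Rightarrow> nat" where
  "distance_sum T v = (\<Sum>x\<in>nodes T. tree_dist T v x)"

lemma card_nodes: "distinct (nodes_list T) \<Longrightarrow> card (nodes T) = tree_size T"
  by (simp add: nodes_def distinct_card)

lemma finite_nodes [simp]: "finite (nodes T)"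
  by (simp add: nodes_def)

text \<open>Moving from a node to its child brings the nodes below the child closer by one and all others farther
away by one.\<close>

lemma distance_sum_child:
  assumes "subtree_at T h (PNode v ts)" "t \<in> set ts" "distinct (nodes_list T)"
  shows "distance_sum T (root_label t) + 2 * tree_size t = distance_sum T v + tree_size T"
proof -
  let ?w = "root_label t"
  have sub: "nodes t \<subseteq> nodes T" using nodes_subtree[OF child[OF assms(1,2)]] .
  have split: "distance_sum T y = (\<Sum>x\<in>nodes t. tree_dist T y x) + (\<Sum>x\<in>nodes T - nodes t. tree_dist T y x)" for y
    unfolding distance_sum_def using sub by (simp add: sum.subset_diff)
  have size_t: "card (nodes t) = tree_size t"
    using card_nodes[OF distinct_nodes_subtree[OF child[OF assms(1,2)] assms(3)]] .
  have "(\<Sum>x\<in>nodes t. tree_dist T v x) = (\<Sum>x\<in>nodes t. Suc (tree_dist T ?w x))"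
    using sub by (intro sum.cong refl tree_dist_child(1)[OF assms]) auto
  also have "\<dots> = (\<Sum>x\<in>nodes t. tree_dist T ?w x) + tree_size t"
    by (simp add: sum_Suc size_t)
  finally have inner: "(\<Sum>x\<in>nodes t. tree_dist T v x) = (\<Sum>x\<in>nodes t. tree_dist T ?w x) + tree_size t" .
  have "(\<Sum>x\<in>nodes T - nodes t. tree_dist T ?w x) = (\<Sum>x\<in>nodes T - nodes t. Suc (tree_dist T v x))"
    by (intro sum.cong refl tree_dist_child(2)[OF assms]) auto
  also have "\<dots> = (\<Sum>x\<in>nodes T - nodes t. tree_dist T v x) + (tree_size T - tree_size t)"
    using sub by (simp add: sum_Suc card_Diff_subset finite_subset[OF sub] size_t card_nodes assms(3))
  finally have outer: "(\<Sum>x\<in>nodes T - nodes t. tree_dist T ?w x) =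
    (\<Sum>x\<in>nodes T - nodes t. tree_dist T v x) + (tree_size T - tree_size t)" .
  have "tree_size t \<le> tree_size T"
    using card_mono[OF _ sub] size_t card_nodes[OF assms(3)] by simp
  then show ?thesis unfolding split inner outer by simp
qed

lemma root_notin_proper_subtree:
  assumes "subtree_at T h s" "distinct (nodes_list T)"
  shows "h = 0 \<and> s = T \<or> root_label T \<notin> nodes s"
  using assms
proof (induction rule: subtree_at.induct)
  case (child h v ts t)
  show ?case
  proof (cases "PNode v ts = T")
    case True
    then show ?thesis using distinct_nodes_child(2)[of v ts t] child by auto
  next
    case False
    then show ?thesis using child by auto
  qed
qed simp

lemma tree_dist_subtree_root:
  assumes "subtree_at T h s" "distinct (nodes_list T)"
  shows "tree_dist T (root_label T) (root_label s) = h"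
  using assms
proof (induction rule: subtree_at.induct)
  case (child h v ts t)
  have "root_label T \<notin> nodes t"
    using root_notin_proper_subtree[OF subtree_at.child[OF child.hyps] child.prems] by simp
  then have "tree_dist T (root_label t) (root_label T) = Suc (tree_dist T v (root_label T))"
    using tree_dist_child(2)[OF child.hyps child.prems] by simp
  then show ?case using child by (simp add: tree_dist_sym)
qed simp

lemma node_is_subtree_root:
  assumes "subtree_at T h s" "y \<in> nodes s"
  shows "\<exists>j t. subtree_at T (h + j) t \<and> root_label t = y \<and> (y \<noteq> root_label s \<longrightarrow> j \<ge> 1)"
  using assms
proof (induction s arbitrary: h rule: plane_tree.induct)
  case (PNode v ts)
  show ?case
  proof (cases "y = v")
    case True
    then show ?thesis using PNode.prems(1) by (intro exI[of _ 0] exI[of _ "PNode v ts"]) simp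
  next
    case False
    then obtain t where t: "t \<in> set ts" "y \<in> nodes t" using PNode.prems(2) by auto
    then obtain j u where "subtree_at T (Suc h + j) u" "root_label u = y"
      using PNode.IH[OF t(1) child[OF PNode.prems(1) t(1)] t(2)] by blast
    then show ?thesis by (intro exI[of _ "Suc j"] exI[of _ u]) simp
  qed
qed

lemma tree_dist_descendant:
  assumes "subtree_at T h s" "distinct (nodes_list T)" "y \<in> nodes s" "y \<noteq> root_label s"
  shows "tree_dist T (root_label T) y > h"
proof -
  obtain j t where "subtree_at T (h + j) t" "root_label t = y" "j \<ge> 1"
    using node_is_subtree_root[OF assms(1,3)] assms(4) by blast
  then show ?thesis using tree_dist_subtree_root[OF _ assms(2), of "h + j" t] by simp
qed

text \<open>Inside a subtree with at most half of the nodes, every step away from its root increases the sum of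
distances or leaves it unchanged.\<close>

lemma distance_sum_light_subtree:
  assumes "subtree_at T h s" "distinct (nodes_list T)" "2 * tree_size s \<le> tree_size T" "y \<in> nodes s"
  shows "distance_sum T (root_label s) \<le> distance_sum T y"
  using assms(1,3,4)
proof (induction s arbitrary: h rule: plane_tree.induct)
  case (PNode v ts)
  show ?case
  proof (cases "y = v")
    case False
    then obtain t where t: "t \<in> set ts" "y \<in> nodes t" using PNode.prems(3) by auto
    have "tree_size t \<le> (\<Sum>t\<leftarrow>ts. tree_size t)"
      using t(1) by (intro member_le_sum_list) auto
    then have light: "2 * tree_size t \<le> tree_size T"
      using PNode.prems(2) by (simp add: length_concat o_def)
    have "distance_sum T v \<le> distance_sum T (root_label t)"
      using distance_sum_child[OF PNode.prems(1) t(1) assms(2)] light by simp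
    also have "\<dots> \<le> distance_sum T y"
      using PNode.IH[OF t(1) child[OF PNode.prems(1) t(1)] light t(2)] .
    finally show ?thesis by simp
  qed simp
qed

lemma large_subtrees_eq_0:
  "tree_size s \<le> M \<Longrightarrow> large_subtrees M h s = 0"
proof (induction h arbitrary: s)
  case (Suc h)
  obtain v ts where s: "s = PNode v ts" by (cases s)
  have "large_subtrees M h t = 0" if "t \<in> set ts" for t
  proof (rule Suc.IH)
    have "tree_size t \<le> (\<Sum>t\<leftarrow>ts. tree_size t)"
      using that by (intro member_le_sum_list) auto
    then show "tree_size t \<le> M" using Suc.prems s by (simp add: length_concat o_def)
  qed
  then show ?case unfolding s by (simp cong: map_cong)
qed simp

text \<open>The descent to the centroid \<open>c\<close>.  At most one child of a node contains more than half of the nodes of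
\<open>T\<close>: if there is one, moving to it strictly decreases the sum of distances, and all other children
are worse; if there is none, the present node is optimal, and any other optimal node lies deeper.  The
last clause records that there is one large subtree at each of the \<open>k + 1\<close> levels passed, and
none below.\<close>

lemma heavy_subtree_centroid:
  assumes "subtree_at T h s" "distinct (nodes_list T)" "tree_size T div 2 < tree_size s"
  shows "\<exists>c k. c \<in> nodes s \<and> tree_dist T (root_label T) c = h + k \<and>
    (\<forall>y\<in>nodes s. y \<noteq> c \<longrightarrow> distance_sum T c < distance_sum T y \<or> distance_sum T c = distance_sum T y \<and>
      tree_dist T (root_label T) c < tree_dist T (root_label T) y) \<and>
    (\<forall>j. large_subtrees (tree_size T div 2) j s = of_bool (j \<le> k))"
  using assms(1,3)
proof (induction s arbitrary: h rule: plane_tree.induct)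
  case (PNode v ts)
  let ?M = "tree_size T div 2" and ?r = "root_label T" and ?D = "distance_sum T"
  note d = distinct_nodes_subtree[OF PNode.prems(1) assms(2)]
  note step = distance_sum_child[OF PNode.prems(1) _ assms(2)]
  note below = child[OF PNode.prems(1)]
  have light_child: "?D v \<le> ?D y" if "t \<in> set ts" "tree_size t \<le> ?M" "y \<in> nodes t" for t y
  proof -
    have "?D v \<le> ?D (root_label t)" using step[OF that(1)] that(2) by linarith
    also have "\<dots> \<le> ?D y"
      using that by (intro distance_sum_light_subtree[OF below[OF that(1)] assms(2)]) linarith+
    finally show ?thesis .
  qed
  have depth_v: "tree_dist T ?r v = h" using tree_dist_subtree_root[OF PNode.prems(1) assms(2)] by simp
  show ?case
  proof (cases "\<exists>t\<in>set ts. ?M < tree_size t")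
    case False
    have "large_subtrees ?M j (PNode v ts) = of_bool (j \<le> 0)" for j
    proof (cases j)
      case (Suc i)
      have "large_subtrees ?M i t = 0" if "t \<in> set ts" for t
        using False that by (intro large_subtrees_eq_0) auto
      then show ?thesis using Suc by (simp cong: map_cong)
    qed (use PNode.prems(2) in simp)
    moreover have "?D v \<le> ?D y \<and> tree_dist T ?r v < tree_dist T ?r y" if y: "y \<in> nodes (PNode v ts)" "y \<noteq> v" for y
    proof -
      obtain t where "t \<in> set ts" "y \<in> nodes t" using y by auto
      then have "?D v \<le> ?D y" using False light_child[of t y] by auto
      moreover have "tree_dist T ?r v < tree_dist T ?r y"
        using tree_dist_descendant[OF PNode.prems(1) assms(2) y(1)] y(2) depth_v by simp
      ultimately show ?thesis by simp
    qed
    ultimately show ?thesis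
      using depth_v by (intro exI[of _ v] exI[of _ 0]) (auto simp: le_less)
  next
    case True
    then obtain t where t: "t \<in> set ts" "?M < tree_size t" by blast
    from t(1) obtain as bs where ts: "ts = as @ t # bs" by (meson split_list)
    have total: "(\<Sum>u\<leftarrow>ts. tree_size u) < tree_size T"
    proof -
      have "card (nodes (PNode v ts)) \<le> card (nodes T)"
        using nodes_subtree[OF PNode.prems(1)] by (intro card_mono) auto
      then have "tree_size (PNode v ts) \<le> tree_size T"
        unfolding card_nodes[OF d] card_nodes[OF assms(2)] .
      then show ?thesis by (simp add: length_concat o_def)
    qed
    have light: "tree_size u \<le> ?M" if "u \<in> set as \<union> set bs" for u
    proof -
      have "tree_size u \<le> (\<Sum>u\<leftarrow>as @ bs. tree_size u)"
        using that by (intro member_le_sum_list) auto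
      then have "tree_size u + tree_size t \<le> (\<Sum>u\<leftarrow>ts. tree_size u)" unfolding ts by simp
      then show ?thesis using total t(2) by linarith
    qed
    obtain c k where c: "c \<in> nodes t" "tree_dist T ?r c = Suc h + k"
      "\<And>y. y \<in> nodes t \<Longrightarrow> y \<noteq> c \<Longrightarrow> ?D c < ?D y \<or> ?D c = ?D y \<and> tree_dist T ?r c < tree_dist T ?r y"
      "\<And>j. large_subtrees ?M j t = of_bool (j \<le> k)"
      using PNode.IH[OF t(1) below[OF t(1)] t(2)] by blast
    have "?D c \<le> ?D (root_label t)" using c(3)[of "root_label t"] by force
    moreover have "?D (root_label t) < ?D v" using step[OF t(1)] t(2) by linarith
    ultimately have Dc: "?D c < ?D v" by simp
    have best: "?D c < ?D y \<or> ?D c = ?D y \<and> tree_dist T ?r c < tree_dist T ?r y"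
      if y: "y \<in> nodes (PNode v ts)" "y \<noteq> c" for y
    proof -
      consider "y = v" | "y \<in> nodes t" | u where "u \<in> set as \<union> set bs" "y \<in> nodes u"
        using y(1) ts by auto
      then show ?thesis
      proof cases
        case 3
        then have "?D v \<le> ?D y" using light light_child[of u y] ts by auto
        then show ?thesis using Dc by simp
      qed (use Dc c(3) y(2) in auto)
    qed
    have count: "large_subtrees ?M j (PNode v ts) = of_bool (j \<le> Suc k)" for j
    proof (cases j)
      case (Suc i)
      have "(\<Sum>u\<leftarrow>us. large_subtrees ?M i u) = 0" if "set us \<subseteq> set as \<union> set bs" for us
        using that light large_subtrees_eq_0 by (induction us) auto
      from this[of as] this[of bs] show ?thesis using Suc c(4) ts by simp
    qed (use PNode.prems(2) in simp)
    have "c \<in> nodes (PNode v ts)" using c(1) t(1) by auto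
    moreover have "tree_dist T ?r c = h + Suc k" using c(2) by simp
    ultimately show ?thesis using best count by blast
  qed
qed

text \<open>For the whole tree the descent ends at the unique centroid nearest to the root.\<close>

lemma large_subtrees_centroid_depth:
  assumes "distinct (nodes_list T)"
  shows "large_subtrees (tree_size T div 2) h T = of_bool (h \<le> centroid_depth T)"
proof -
  have "tree_size T div 2 < tree_size T" by (cases T) auto
  then obtain c k where c: "c \<in> nodes T" "tree_dist T (root_label T) c = k"
      "\<And>y. y \<in> nodes T \<Longrightarrow> y \<noteq> c \<Longrightarrow> distance_sum T c < distance_sum T y \<or> distance_sum T c = distance_sum T y \<and>
        tree_dist T (root_label T) c < tree_dist T (root_label T) y"
      "\<And>j. large_subtrees (tree_size T div 2) j T = of_bool (j \<le> k)"
    using heavy_subtree_centroid[OF subtree_at.root assms] by auto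
  have cent: "is_centroid T y \<longleftrightarrow> y \<in> nodes T \<and> (\<forall>w\<in>nodes T. distance_sum T y \<le> distance_sum T w)" for y
    by (simp add: is_centroid_def distance_sum_def)
  have c_min: "is_centroid T c"
    unfolding cent using c(1,3) by (metis less_imp_le order_refl)
  have "is_arg_min (tree_dist T (root_label T)) (is_centroid T) y \<longleftrightarrow> y = c" for y
  proof
    assume y: "is_arg_min (tree_dist T (root_label T)) (is_centroid T) y"
    show "y = c"
    proof (rule ccontr)
      assume "y \<noteq> c"
      moreover have "y \<in> nodes T" "distance_sum T y \<le> distance_sum T c"
        using y c_min unfolding is_arg_min_def cent by auto
      ultimately have "tree_dist T (root_label T) c < tree_dist T (root_label T) y"
        using c(3) by fastforce
      then show False using y c_min by (auto simp: is_arg_min_def)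
    qed
  next
    assume "y = c"
    have "\<not> tree_dist T (root_label T) z < tree_dist T (root_label T) c" if "is_centroid T z" for z
    proof
      assume less: "tree_dist T (root_label T) z < tree_dist T (root_label T) c"
      have "z \<in> nodes T" "distance_sum T z \<le> distance_sum T c"
        using that c(1) unfolding cent by auto
      then show False using c(3)[of z] less by fastforce
    qed
    then show "is_arg_min (tree_dist T (root_label T)) (is_centroid T) y"
      using \<open>y = c\<close> c_min by (auto simp: is_arg_min_def)
  qed
  then have "is_arg_min (tree_dist T (root_label T)) (is_centroid T) = (\<lambda>y. y = c)" by blast
  then have "centroid T = c"
    unfolding centroid_def arg_min_def by simp
  then show ?thesis using c(2,4) by (simp add: centroid_depth_def)
qed

section \<open>Asymptotics of the chain sums\<close>

abbreviation reciprocal_sum :: "nat \<Rightarrow> nat \<Rightarrow> real" where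
  "reciprocal_sum M n \<equiv> \<Sum>k\<in>{M<..<n}. 1 / real k"

lemma reciprocal_sum_nonneg: "reciprocal_sum M n \<ge> 0"
  by (intro sum_nonneg) auto

lemma reciprocal_sum_le_1:
  assumes "n \<le> 2 * M + 1"
  shows "reciprocal_sum M n \<le> 1"
proof -
  have "reciprocal_sum M n \<le> (\<Sum>k\<in>{M<..<n}. 1 / real (Suc M))"
    by (intro sum_mono divide_left_mono) auto
  also have "\<dots> = real (n - Suc M) / real (Suc M)" by simp
  also have "\<dots> \<le> 1" using assms by simp
  finally show ?thesis .
qed

text \<open>The mean value theorem for powers.\<close>

lemma power_Suc_diff_bounds:
  fixes a b :: real
  assumes "0 \<le> b" "b \<le> a"
  shows "real (Suc j) * b ^ j * (a - b) \<le> a ^ Suc j - b ^ Suc j"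
    and "a ^ Suc j - b ^ Suc j \<le> real (Suc j) * a ^ j * (a - b)"
proof -
  have "a ^ Suc j - b ^ Suc j = (a - b) * (\<Sum>i<Suc j. a ^ i * b ^ (j - i))"
    unfolding diff_power_eq_sum ..
  moreover have "(\<Sum>i<Suc j. b ^ j) \<le> (\<Sum>i<Suc j. a ^ i * b ^ (j - i))"
  proof (rule sum_mono)
    fix i assume "i \<in> {..<Suc j}"
    then have "b ^ j = b ^ i * b ^ (j - i)" by (simp flip: power_add)
    also have "\<dots> \<le> a ^ i * b ^ (j - i)" using assms by (intro mult_right_mono power_mono) auto
    finally show "b ^ j \<le> a ^ i * b ^ (j - i)" .
  qed
  moreover have "(\<Sum>i<Suc j. a ^ i * b ^ (j - i)) \<le> (\<Sum>i<Suc j. a ^ j)"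
  proof (rule sum_mono)
    fix i assume "i \<in> {..<Suc j}"
    then have "a ^ j = a ^ i * a ^ (j - i)" by (simp flip: power_add)
    moreover have "a ^ i * b ^ (j - i) \<le> a ^ i * a ^ (j - i)" using assms by (intro mult_left_mono power_mono) auto
    ultimately show "a ^ i * b ^ (j - i) \<le> a ^ j" by simp
  qed
  ultimately show "real (Suc j) * b ^ j * (a - b) \<le> a ^ Suc j - b ^ Suc j"
    and "a ^ Suc j - b ^ Suc j \<le> real (Suc j) * a ^ j * (a - b)"
    using assms mult_left_mono[of "\<Sum>i<Suc j. b ^ j" "\<Sum>i<Suc j. a ^ i * b ^ (j - i)" "a - b"]
      mult_left_mono[of "\<Sum>i<Suc j. a ^ i * b ^ (j - i)" "\<Sum>i<Suc j. a ^ j" "a - b"]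
    by (simp_all add: mult.commute del: power_Suc of_nat_Suc sum.lessThan_Suc)
qed

lemma sum_greaterThanLessThan_telescope:
  fixes f :: "nat \<Rightarrow> real"
  assumes "M < n"
  shows "(\<Sum>k\<in>{M<..<n}. f (Suc k) - f k) = f n - f (Suc M)"
proof -
  have "{M<..<n} = {Suc M..<n}" by auto
  then show ?thesis using assms by (simp add: sum_Suc_diff')
qed

lemma reciprocal_sum_Suc: "M < k \<Longrightarrow> reciprocal_sum M (Suc k) = reciprocal_sum M k + 1 / real k"
  by (simp add: greaterThanLessThan_Suc)

lemma reciprocal_sum_empty [simp]: "reciprocal_sum M (Suc M) = 0"
proof -
  have "{M<..<Suc M} = {}" by auto
  then show ?thesis by simp
qed

text \<open>An elementary symmetric polynomial of degree \<open>j\<close> differs from the \<open>j\<close>-th power of the sum, divided by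
\<open>fact j\<close>, by terms with a repeated index only.  As all summands are at most \<open>1 / M\<close> and the sum is at
most \<open>1\<close>, these terms are of order \<open>1 / M\<close>.\<close>

lemma chain_sum_one_approx:
  assumes "M \<ge> 1" "M < n" "n \<le> 2 * M + 1"
  shows "0 \<le> reciprocal_sum M n ^ j / fact j - chain_sum (\<lambda>_. 1) M j n \<and>
    reciprocal_sum M n ^ j / fact j - chain_sum (\<lambda>_. 1) M j n \<le> real j / real M"
  using assms(2,3)
proof (induction j arbitrary: n)
  case (Suc j)
  let ?H = "reciprocal_sum M" and ?C = "chain_sum (\<lambda>_. 1) M"
  \<comment> \<open>Both sides are sums over the largest index k of increments of order 1 / k; the increments
    are compared one by one.\<close>
  have "?H n ^ Suc j / fact (Suc j) = (\<Sum>k\<in>{M<..<n}. ?H (Suc k) ^ Suc j / fact (Suc j) - ?H k ^ Suc j / fact (Suc j))"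
    using sum_greaterThanLessThan_telescope[OF Suc(2), of "\<lambda>k. ?H k ^ Suc j / fact (Suc j)"] by simp
  then have eq: "?H n ^ Suc j / fact (Suc j) - ?C (Suc j) n =
      (\<Sum>k\<in>{M<..<n}. (?H (Suc k) ^ Suc j - ?H k ^ Suc j) / fact (Suc j) - ?C j k / real k)"
    by (simp add: sum_subtractf diff_divide_distrib)
  have bounds: "(1 / real k) * (?H k ^ j / fact j) \<le> (?H (Suc k) ^ Suc j - ?H k ^ Suc j) / fact (Suc j)"
    "(?H (Suc k) ^ Suc j - ?H k ^ Suc j) / fact (Suc j) \<le> (1 / real k) * (?H (Suc k) ^ j / fact j)"
    if "M < k" for k
  proof -
    have d: "?H (Suc k) - ?H k = 1 / real k" using reciprocal_sum_Suc[OF that] by simp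
    have le: "?H k \<le> ?H (Suc k)" using d by (smt (verit) divide_nonneg_nonneg of_nat_0_le_iff)
    have f: "fact (Suc j) = real (Suc j) * fact j" by simp
    note b = power_Suc_diff_bounds[OF reciprocal_sum_nonneg le, of j, unfolded d]
    have c: "real (Suc j) * x * (1 / real k) / fact (Suc j) = (1 / real k) * (x / fact j)" for x
      unfolding f by (simp del: of_nat_Suc)
    show "(1 / real k) * (?H k ^ j / fact j) \<le> (?H (Suc k) ^ Suc j - ?H k ^ Suc j) / fact (Suc j)"
      using divide_right_mono[OF b(1), of "fact (Suc j)"] unfolding c by (simp del: fact_Suc power_Suc)
    show "(?H (Suc k) ^ Suc j - ?H k ^ Suc j) / fact (Suc j) \<le> (1 / real k) * (?H (Suc k) ^ j / fact j)"
      using divide_right_mono[OF b(2), of "fact (Suc j)"] unfolding c by (simp del: fact_Suc power_Suc)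
  qed
  have "0 \<le> ?H n ^ Suc j / fact (Suc j) - ?C (Suc j) n"
    unfolding eq
  proof (rule sum_nonneg)
    fix k assume k: "k \<in> {M<..<n}"
    then have "0 \<le> (1 / real k) * (?H k ^ j / fact j - ?C j k)"
      using Suc.IH[of k] Suc.prems by (intro mult_nonneg_nonneg) auto
    also have "\<dots> = (1 / real k) * (?H k ^ j / fact j) - ?C j k / real k"
      by (simp add: right_diff_distrib)
    finally show "0 \<le> (?H (Suc k) ^ Suc j - ?H k ^ Suc j) / fact (Suc j) - ?C j k / real k"
      using bounds(1)[of k] k by simp
  qed
  moreover have "?H n ^ Suc j / fact (Suc j) - ?C (Suc j) n \<le> real (Suc j) / real M"
  proof -
    \<comment> \<open>The error of an increment has two parts: the error for j at the index k, and the change of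
      the power between k and k + 1, whose sum over k telescopes.\<close>
    have "?H n ^ Suc j / fact (Suc j) - ?C (Suc j) n \<le>
      (\<Sum>k\<in>{M<..<n}. (real j / real M) * (1 / real k) + (1 / real M) * (?H (Suc k) ^ j / fact j - ?H k ^ j / fact j))"
      unfolding eq
    proof (rule sum_mono)
      fix k assume k: "k \<in> {M<..<n}"
      have "?H k ^ j \<le> ?H (Suc k) ^ j"
        using k reciprocal_sum_Suc[of M k] reciprocal_sum_nonneg[of M k] by (intro power_mono) auto
      then have mono: "0 \<le> ?H (Suc k) ^ j / fact j - ?H k ^ j / fact j"
        by (simp add: divide_right_mono)
      have "(?H (Suc k) ^ Suc j - ?H k ^ Suc j) / fact (Suc j) - ?C j k / real k \<le>
          (1 / real k) * (?H k ^ j / fact j - ?C j k) + (1 / real k) * (?H (Suc k) ^ j / fact j - ?H k ^ j / fact j)"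
        using bounds(2)[of k] k by (simp add: right_diff_distrib)
      also have "\<dots> \<le> (1 / real k) * (real j / real M) + (1 / real M) * (?H (Suc k) ^ j / fact j - ?H k ^ j / fact j)"
        using Suc.IH[of k] Suc.prems k mono assms(1)
        by (intro add_mono mult_left_mono mult_right_mono divide_left_mono) auto
      finally show "(?H (Suc k) ^ Suc j - ?H k ^ Suc j) / fact (Suc j) - ?C j k / real k \<le>
          (real j / real M) * (1 / real k) + (1 / real M) * (?H (Suc k) ^ j / fact j - ?H k ^ j / fact j)"
        by (simp add: mult.commute)
    qed
    also have "\<dots> = (real j / real M) * ?H n + (1 / real M) * (?H n ^ j / fact j - ?H (Suc M) ^ j / fact j)"
      unfolding sum.distrib sum_distrib_left[symmetric]
        sum_greaterThanLessThan_telescope[OF Suc(2), of "\<lambda>k. ?H k ^ j / fact j"] ..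
    also have "\<dots> \<le> (real j / real M) * 1 + (1 / real M) * 1"
    proof (intro add_mono mult_left_mono)
      have H: "?H n \<le> 1" using reciprocal_sum_le_1[OF Suc(3)] .
      show "?H n \<le> 1" by fact
      have "?H n ^ j / fact j \<le> 1 / 1"
        using H reciprocal_sum_nonneg[of M n] by (intro frac_le power_le_one) auto
      moreover have "?H (Suc M) ^ j / fact j \<ge> 0" using reciprocal_sum_nonneg[of M "Suc M"] by simp
      ultimately show "?H n ^ j / fact j - ?H (Suc M) ^ j / fact j \<le> 1" by linarith
    qed auto
    also have "\<dots> = real (Suc j) / real M" by (simp add: add_divide_distrib)
    finally show ?thesis .
  qed
  ultimately show ?case ..
qed simp

lemma half_at_top: "filterlim (\<lambda>n::nat. n div 2) sequentially sequentially"
proof (rule filterlim_at_top[THEN iffD2], intro allI)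
  fix Z :: nat
  show "\<forall>\<^sub>F n in sequentially. Z \<le> n div 2"
    using eventually_ge_at_top[of "2 * Z"] by eventually_elim auto
qed

lemma half_inverse_tendsto: "(\<lambda>n. 1 / real (n div 2)) \<longlonglongrightarrow> 0"
  using filterlim_compose[OF lim_1_over_n half_at_top] by simp

text \<open>A difference of two harmonic numbers, in which Euler's constant cancels.\<close>

lemma reciprocal_sum_tendsto: "(\<lambda>n. reciprocal_sum (n div 2) n) \<longlonglongrightarrow> ln 2"
proof -
  have ratio: "(\<lambda>n. real n / real (n div 2)) \<longlonglongrightarrow> 2"
  proof (rule tendsto_sandwich)
    show "\<forall>\<^sub>F n in sequentially. 2 \<le> real n / real (n div 2)"
      using eventually_ge_at_top[of 2]
    proof eventually_elim
      case (elim n)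
      then have "real (n div 2) > 0" "2 * real (n div 2) \<le> real n" by linarith+
      then show ?case by (simp add: field_simps)
    qed
    show "\<forall>\<^sub>F n in sequentially. real n / real (n div 2) \<le> 2 + 1 / real (n div 2)"
      using eventually_ge_at_top[of 2]
    proof eventually_elim
      case (elim n)
      then have "real (n div 2) > 0" "real n \<le> 2 * real (n div 2) + 1" by linarith+
      then show ?case by (simp add: field_simps)
    qed
    show "(\<lambda>n. 2 + 1 / real (n div 2)) \<longlonglongrightarrow> 2"
      using tendsto_add[OF tendsto_const half_inverse_tendsto, of 2] by simp
  qed simp
  have g: "(\<lambda>n. harm n - ln (real n)) \<longlonglongrightarrow> (euler_mascheroni :: real)"
    using euler_mascheroni_LIMSEQ .
  have "(\<lambda>n. (harm n - ln (real n)) - (harm (n div 2) - ln (real (n div 2))) + ln (real n / real (n div 2)) - 1 / real n)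
      \<longlonglongrightarrow> euler_mascheroni - euler_mascheroni + ln 2 - 0"
    by (intro tendsto_intros g filterlim_compose[OF g half_at_top] ratio lim_1_over_n) auto
  then have "(\<lambda>n. (harm n - ln (real n)) - (harm (n div 2) - ln (real (n div 2))) + ln (real n / real (n div 2)) - 1 / real n)
      \<longlonglongrightarrow> ln 2" by simp
  then show ?thesis
  proof (rule Lim_transform_eventually)
    show "\<forall>\<^sub>F n in sequentially. (harm n - ln (real n)) - (harm (n div 2) - ln (real (n div 2))) +
        ln (real n / real (n div 2)) - 1 / real n = reciprocal_sum (n div 2) n"
      using eventually_ge_at_top[of 2]
    proof eventually_elim
      case (elim n)
      have "{1..n} = {1..n div 2} \<union> insert n {n div 2<..<n}" using elim by auto
      then have "harm n = harm (n div 2) + (\<Sum>k\<in>insert n {n div 2<..<n}. 1 / real k)"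
        unfolding harm_def by (simp only:) (subst sum.union_disjoint; auto simp: inverse_eq_divide)
      then have "harm n = harm (n div 2) + reciprocal_sum (n div 2) n + 1 / real n"
        by simp
      moreover have "ln (real n / real (n div 2)) = ln (real n) - ln (real (n div 2))"
        using elim by (subst ln_div) auto
      ultimately show ?case by simp
    qed
  qed
qed

lemma chain_sum_one_tendsto: "(\<lambda>n. chain_sum (\<lambda>_. 1) (n div 2) j n) \<longlonglongrightarrow> ln 2 ^ j / fact j"
proof -
  let ?D = "\<lambda>n. reciprocal_sum (n div 2) n ^ j / fact j - chain_sum (\<lambda>_. 1) (n div 2) j n"
  have approx: "\<forall>\<^sub>F n in sequentially. 0 \<le> ?D n \<and> ?D n \<le> real j / real (n div 2)"
    using eventually_ge_at_top[of 2] by eventually_elim (rule chain_sum_one_approx; linarith)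
  have "?D \<longlonglongrightarrow> 0"
  proof (rule tendsto_sandwich)
    show "\<forall>\<^sub>F n in sequentially. 0 \<le> ?D n" "\<forall>\<^sub>F n in sequentially. ?D n \<le> real j / real (n div 2)"
      using approx by (eventually_elim, simp)+
    show "(\<lambda>n. real j / real (n div 2)) \<longlonglongrightarrow> 0"
      using tendsto_mult[OF tendsto_const half_inverse_tendsto, of "real j"] by simp
  qed simp
  moreover have "(\<lambda>n. reciprocal_sum (n div 2) n ^ j / fact j) \<longlonglongrightarrow> ln 2 ^ j / fact j"
    by (intro tendsto_intros reciprocal_sum_tendsto) auto
  ultimately show ?thesis
    using tendsto_diff by fastforce
qed

text \<open>Taking logarithms, \<open>q n / q (M + 1)\<close> becomes the sum of \<open>ln (1 + (a - 1) / k)\<close>, which is \<open>a - 1\<close>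
times the sum of the \<open>1 / k\<close> up to an error bounded by the sum of \<open>2 * ((a - 1) / k)\<^sup>2\<close>.\<close>

lemma scaled_weight_ratio_tendsto:
  assumes "a > 0"
  shows "(\<lambda>n. scaled_weight a (Suc (n div 2)) / scaled_weight a n) \<longlonglongrightarrow> 2 powr (1 - a)"
proof -
  let ?z = "a - 1"
  let ?L = "\<lambda>n. \<Sum>k\<in>{n div 2<..<n}. ln (1 + ?z / real k)"
  have split: "scaled_weight a n = scaled_weight a (Suc (n div 2)) * exp (?L n)" if "n \<ge> 2" for n
  proof -
    have "{0<..<n} = {0<..<Suc (n div 2)} \<union> {n div 2<..<n}" using that by auto
    then have "scaled_weight a n = scaled_weight a (Suc (n div 2)) * (\<Prod>k\<in>{n div 2<..<n}. 1 + ?z / real k)"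
      unfolding scaled_weight_def by (simp only:) (rule prod.union_disjoint; auto)
    also have "(\<Prod>k\<in>{n div 2<..<n}. 1 + ?z / real k) = exp (?L n)"
      unfolding exp_sum[OF finite_greaterThanLessThan]
    proof (rule prod.cong[OF refl])
      fix k assume "k \<in> {n div 2<..<n}"
      then have "1 + ?z / real k > 0" using assms by (simp add: field_simps)
      then show "1 + ?z / real k = exp (ln (1 + ?z / real k))" by simp
    qed
    finally show ?thesis .
  qed
  have "(\<lambda>n. ?L n - ?z * reciprocal_sum (n div 2) n) \<longlonglongrightarrow> 0"
  proof (rule tendsto_0_le[where K = 1])
    show "(\<lambda>n. 2 * ?z ^ 2 * (1 / real (n div 2))) \<longlonglongrightarrow> 0"
      using tendsto_mult[OF tendsto_const half_inverse_tendsto, of "2 * ?z ^ 2"] by simp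
    \<comment> \<open>The bound on n div 2 ensures that the logarithm is evaluated within distance 1 / 2 of 1.\<close>
    have "\<forall>\<^sub>F n in sequentially. n div 2 \<ge> nat \<lceil>2 * \<bar>?z\<bar>\<rceil> + 1"
      using filterlim_at_top[THEN iffD1, OF half_at_top] by blast
    then show "\<forall>\<^sub>F n in sequentially. norm (?L n - ?z * reciprocal_sum (n div 2) n) \<le>
        norm (2 * ?z ^ 2 * (1 / real (n div 2))) * 1"
    proof eventually_elim
      case (elim n)
      let ?M = "n div 2"
      have M: "2 * \<bar>?z\<bar> \<le> real ?M" "real ?M > 0" using elim by linarith+
      have "?L n - ?z * reciprocal_sum ?M n = (\<Sum>k\<in>{?M<..<n}. ln (1 + ?z / real k) - ?z / real k)"
        by (simp add: sum_subtractf sum_distrib_left)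
      then have "\<bar>?L n - ?z * reciprocal_sum ?M n\<bar> \<le> (\<Sum>k\<in>{?M<..<n}. \<bar>ln (1 + ?z / real k) - ?z / real k\<bar>)"
        by simp
      also have "\<dots> \<le> (\<Sum>k\<in>{?M<..<n}. 2 * ?z ^ 2 * (1 / real ?M) * (1 / real k))"
      proof (rule sum_mono)
        fix k assume k: "k \<in> {?M<..<n}"
        then have "2 * \<bar>?z\<bar> \<le> real k" "real k > 0" using M by auto
        then have "\<bar>?z / real k\<bar> \<le> 1 / 2" by (simp add: field_simps)
        then have "\<bar>ln (1 + ?z / real k) - ?z / real k\<bar> \<le> 2 * (?z / real k) ^ 2"
          by (rule abs_ln_one_plus_x_minus_x_bound)
        also have "\<dots> = 2 * ?z ^ 2 * (1 / real k) * (1 / real k)"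
          by (simp add: power2_eq_square)
        also have "\<dots> \<le> 2 * ?z ^ 2 * (1 / real ?M) * (1 / real k)"
          using k M by (intro mult_right_mono mult_left_mono divide_left_mono) auto
        finally show "\<bar>ln (1 + ?z / real k) - ?z / real k\<bar> \<le> 2 * ?z ^ 2 * (1 / real ?M) * (1 / real k)" .
      qed
      also have "\<dots> = 2 * ?z ^ 2 * (1 / real ?M) * reciprocal_sum ?M n"
        by (simp add: sum_distrib_left)
      also have "\<dots> \<le> 2 * ?z ^ 2 * (1 / real ?M) * 1"
        by (intro mult_left_mono reciprocal_sum_le_1) auto
      finally show ?case by simp
    qed
  qed
  then have "(\<lambda>n. (?L n - ?z * reciprocal_sum (n div 2) n) + ?z * reciprocal_sum (n div 2) n) \<longlonglongrightarrow> 0 + ?z * ln 2"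
    by (intro tendsto_intros reciprocal_sum_tendsto)
  then have "?L \<longlonglongrightarrow> ?z * ln 2" by simp
  then have "(\<lambda>n. exp (- ?L n)) \<longlonglongrightarrow> exp (- (?z * ln 2))" by (intro tendsto_intros)
  then have "(\<lambda>n. exp (- ?L n)) \<longlonglongrightarrow> 2 powr (1 - a)" by (simp add: powr_def algebra_simps)
  then show ?thesis
  proof (rule Lim_transform_eventually)
    show "\<forall>\<^sub>F n in sequentially. exp (- ?L n) = scaled_weight a (Suc (n div 2)) / scaled_weight a n"
      using eventually_ge_at_top[of 2]
    proof eventually_elim
      case (elim n)
      show ?case
        unfolding split[OF elim] using scaled_weight_pos[OF assms, of "Suc (n div 2)"] by (simp add: exp_minus field_simps)
    qed
  qed
qed

text \<open>At \<open>a = 1\<close> the expression \<open>depth_tail\<close> divides by zero; the value used here is its limit, see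
\<open>depth_tail_tendsto_at_1\<close>.\<close>

definition tail_limit :: "real \<Rightarrow> nat \<Rightarrow> real" where
  "tail_limit a h = (if a = 1 then ln 2 ^ h / fact h else depth_tail a h)"

lemma depth_tail_Suc:
  assumes "a \<noteq> 1"
  shows "depth_tail a (Suc h) = a / (a - 1) * (depth_tail a h - a ^ h * 2 powr (1 - a) * (ln 2 ^ h / fact h))"
proof -
  have "(a / (a - 1)) ^ h * ((a - 1) * ln 2) ^ h = a ^ h * ln 2 ^ h"
    using assms by (simp add: power_mult_distrib power_divide)
  then have "(a / (a - 1)) ^ h * (2 powr (1 - a) * (((a - 1) * ln 2) ^ h / fact h)) = a ^ h * 2 powr (1 - a) * (ln 2 ^ h / fact h)"
    by (simp add: field_simps)
  then show ?thesis
    unfolding depth_tail_def sum.lessThan_Suc power_Suc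
    by (simp only: right_diff_distrib distrib_left mult.assoc mult_1_right diff_diff_eq)
qed

lemma depth_mass_eq:
  assumes "a \<noteq> 1"
  shows "depth_mass a h = depth_tail a h - depth_tail a (Suc h)"
proof -
  let ?S = "\<Sum>j<h. ((a - 1) * ln 2) ^ j / fact j" and ?t = "((a - 1) * ln 2) ^ h / fact h"
    and ?p = "2 powr (1 - a)"
  have "depth_tail a h - depth_tail a (Suc h) =
      (a / (a - 1)) ^ h * ((1 - ?p * ?S) - a / (a - 1) * (1 - ?p * (?S + ?t)))"
    unfolding depth_tail_def sum.lessThan_Suc power_Suc
    by (simp only: right_diff_distrib mult.assoc mult.left_commute)
  also have "(1 - ?p * ?S) - a / (a - 1) * (1 - ?p * (?S + ?t)) = (?p * (?S + a * ?t) - 1) / (a - 1)"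
    using assms by (simp add: field_simps)
  finally show ?thesis
    unfolding depth_mass_def by (simp add: power_divide)
qed

lemma chain_sum_scaled_weight_tendsto:
  assumes "a > 0"
  shows "(\<lambda>n. a ^ h * chain_sum (scaled_weight a) (n div 2) h n / scaled_weight a n) \<longlonglongrightarrow> tail_limit a h"
proof (cases "a = 1")
  case True
  have "scaled_weight 1 = (\<lambda>_. 1)" by (simp add: scaled_weight_def[abs_def])
  then show ?thesis using chain_sum_one_tendsto[of h] True by (simp add: tail_limit_def)
next
  case False
  show ?thesis
  proof (induction h)
    case 0
    have "\<forall>\<^sub>F n in sequentially. 1 = a ^ 0 * chain_sum (scaled_weight a) (n div 2) 0 n / scaled_weight a n"
      using eventually_ge_at_top[of 1]
      by eventually_elim (use scaled_weight_pos[OF assms] in \<open>auto simp: order_less_imp_not_eq2\<close>)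
    then show ?case
      using False by (intro Lim_transform_eventually[OF tendsto_const]) (auto simp: tail_limit_def depth_tail_def)
  next
    case (Suc h)
    let ?C = "\<lambda>n. chain_sum (scaled_weight a) (n div 2)"
    have "(\<lambda>n. a / (a - 1) * (a ^ h * ?C n h n / scaled_weight a n -
          a ^ h * (scaled_weight a (Suc (n div 2)) / scaled_weight a n) * chain_sum (\<lambda>_. 1) (n div 2) h n))
        \<longlonglongrightarrow> a / (a - 1) * (tail_limit a h - a ^ h * 2 powr (1 - a) * (ln 2 ^ h / fact h))"
      by (intro tendsto_intros Suc scaled_weight_ratio_tendsto chain_sum_one_tendsto assms)
    moreover have "a / (a - 1) * (a ^ h * ?C n h n / scaled_weight a n -
          a ^ h * (scaled_weight a (Suc (n div 2)) / scaled_weight a n) * chain_sum (\<lambda>_. 1) (n div 2) h n) =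
        a ^ Suc h * ?C n (Suc h) n / scaled_weight a n" for n
    proof -
      have "?C n (Suc h) n = (?C n h n - scaled_weight a (Suc (n div 2)) * chain_sum (\<lambda>_. 1) (n div 2) h n) / (a - 1)"
        using chain_sum_scaled_weight_Suc[of a "n div 2" h n] False by (simp add: field_simps del: chain_sum.simps)
      then show ?thesis by (simp add: diff_divide_distrib right_diff_distrib del: chain_sum.simps)
    qed
    ultimately show ?case
      using False by (simp add: tail_limit_def depth_tail_Suc del: chain_sum.simps)
  qed
qed

text \<open>The sum in \<open>depth_tail\<close> is a Taylor polynomial of \<open>exp x\<close>, and \<open>2 powr (1 - a) = exp (- x)\<close>.  With the
Lagrange form of the remainder the powers of \<open>a - 1\<close> cancel, which gives estimates that are uniform
near the singularity and summable in \<open>h\<close>.\<close>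

lemma depth_tail_bounds:
  assumes "a > 0" "a \<noteq> 1"
  defines "x \<equiv> (a - 1) * ln 2"
  shows "(a * ln 2) ^ h / fact h * exp (- 2 * \<bar>x\<bar>) \<le> depth_tail a h"
    and "depth_tail a h \<le> (a * ln 2) ^ h / fact h * exp (2 * \<bar>x\<bar>)"
proof -
  obtain t where t: "\<bar>t\<bar> \<le> \<bar>x\<bar>" "exp x = (\<Sum>m<h. x ^ m / fact m) + exp t / fact h * x ^ h"
    using Maclaurin_exp_le[of x h] by blast
  have "2 powr (1 - a) = exp (- x)" by (simp add: powr_def x_def algebra_simps)
  moreover have "(\<Sum>m<h. x ^ m / fact m) = exp x - exp t / fact h * x ^ h" using t(2) by simp
  ultimately have "depth_tail a h = (a / (a - 1)) ^ h * (1 - exp (- x) * (exp x - exp t / fact h * x ^ h))"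
    unfolding depth_tail_def x_def by simp
  also have "\<dots> = (a / (a - 1)) ^ h * x ^ h / fact h * exp (t - x)"
    by (simp add: right_diff_distrib exp_diff exp_minus field_simps)
  also have "(a / (a - 1)) ^ h * x ^ h = (a * ln 2) ^ h"
    using assms by (simp add: x_def power_mult_distrib power_divide)
  finally have eq: "depth_tail a h = (a * ln 2) ^ h / fact h * exp (t - x)" .
  have "(a * ln 2) ^ h / fact h \<ge> 0" using assms by simp
  moreover have "- 2 * \<bar>x\<bar> \<le> t - x" "t - x \<le> 2 * \<bar>x\<bar>" using t(1) by linarith+
  ultimately show "(a * ln 2) ^ h / fact h * exp (- 2 * \<bar>x\<bar>) \<le> depth_tail a h"
    "depth_tail a h \<le> (a * ln 2) ^ h / fact h * exp (2 * \<bar>x\<bar>)"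
    unfolding eq by (intro mult_left_mono; simp)+
qed

lemma depth_tail_tendsto_at_1: "((\<lambda>a. depth_tail a h) \<longlongrightarrow> tail_limit 1 h) (at 1)"
proof (rule tendsto_sandwich)
  have near: "\<forall>\<^sub>F a in at 1. a > 0 \<and> a \<noteq> (1::real)"
    using order_tendstoD(1)[OF tendsto_ident_at, of 0 "1::real"] eventually_neq_at_within[of "1::real" 1]
    by (auto intro: eventually_conj)
  show "\<forall>\<^sub>F a in at 1. (a * ln 2) ^ h / fact h * exp (- 2 * \<bar>(a - 1) * ln 2\<bar>) \<le> depth_tail a h"
    using near by eventually_elim (blast intro: depth_tail_bounds)
  show "\<forall>\<^sub>F a in at 1. depth_tail a h \<le> (a * ln 2) ^ h / fact h * exp (2 * \<bar>(a - 1) * ln 2\<bar>)"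
    using near by eventually_elim (blast intro: depth_tail_bounds)
  have "((\<lambda>a. (a * ln 2) ^ h / fact h * exp (- 2 * \<bar>(a - 1) * ln 2\<bar>)) \<longlongrightarrow>
      (1 * ln 2) ^ h / fact h * exp (- 2 * \<bar>(1 - 1) * ln (2::real)\<bar>)) (at 1)"
    by (intro tendsto_intros) auto
  then show "((\<lambda>a. (a * ln 2) ^ h / fact h * exp (- 2 * \<bar>(a - 1) * ln 2\<bar>)) \<longlongrightarrow> tail_limit 1 h) (at 1)"
    by (simp add: tail_limit_def)
  have "((\<lambda>a. (a * ln 2) ^ h / fact h * exp (2 * \<bar>(a - 1) * ln 2\<bar>)) \<longlongrightarrow>
      (1 * ln 2) ^ h / fact h * exp (2 * \<bar>(1 - 1) * ln (2::real)\<bar>)) (at 1)"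
    by (intro tendsto_intros) auto
  then show "((\<lambda>a. (a * ln 2) ^ h / fact h * exp (2 * \<bar>(a - 1) * ln 2\<bar>)) \<longlongrightarrow> tail_limit 1 h) (at 1)"
    by (simp add: tail_limit_def)
qed

lemma tail_limit_tendsto_0:
  assumes "a > 0"
  shows "tail_limit a \<longlonglongrightarrow> 0"
proof -
  have pw: "(\<lambda>h. x ^ h / fact h) \<longlonglongrightarrow> 0" for x :: real
    using summable_LIMSEQ_zero[OF summable_exp, of x] by (simp add: field_simps)
  show ?thesis
  proof (cases "a = 1")
    case False
    let ?x = "(a - 1) * ln 2"
    have "depth_tail a \<longlonglongrightarrow> 0"
    proof (rule tendsto_sandwich)
      show "\<forall>\<^sub>F h in sequentially. (a * ln 2) ^ h / fact h * exp (- 2 * \<bar>?x\<bar>) \<le> depth_tail a h"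
        "\<forall>\<^sub>F h in sequentially. depth_tail a h \<le> (a * ln 2) ^ h / fact h * exp (2 * \<bar>?x\<bar>)"
        using depth_tail_bounds[OF assms False] by auto
      show "(\<lambda>h. (a * ln 2) ^ h / fact h * exp (- 2 * \<bar>?x\<bar>)) \<longlonglongrightarrow> 0"
        "(\<lambda>h. (a * ln 2) ^ h / fact h * exp (2 * \<bar>?x\<bar>)) \<longlonglongrightarrow> 0"
        using tendsto_mult[OF pw tendsto_const] by fastforce+
    qed
    moreover have "tail_limit a = depth_tail a" using False by (auto simp: tail_limit_def)
    ultimately show ?thesis by simp
  next
    case True
    then show ?thesis using pw[of "ln 2"] by (simp add: tail_limit_def[abs_def])
  qed
qed

section \<open>The limit law\<close>

lemma prob_random_tree:
  assumes "very_simple_family c1 c2" "n \<ge> 1"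
  shows "measure_pmf.prob (random_tree c1 c2 n) {T. P T} =
    (\<Sum>T\<in>increasing_trees n. weight c1 c2 T * of_bool (P T)) / total_weight c1 c2 n"
proof -
  let ?p = "random_tree c1 c2 n"
  have "set_pmf ?p \<subseteq> increasing_trees n"
    using pmf_random_tree[OF assms] by (auto simp: set_pmf_eq split: if_splits)
  then have "{T. P T} \<inter> set_pmf ?p = {T\<in>increasing_trees n. P T} \<inter> set_pmf ?p" by auto
  then have "measure_pmf.prob ?p {T. P T} = measure_pmf.prob ?p {T\<in>increasing_trees n. P T}"
    by (metis measure_Int_set_pmf)
  also have "\<dots> = (\<Sum>T\<in>{T\<in>increasing_trees n. P T}. weight c1 c2 T / total_weight c1 c2 n)"
    using finite_increasing_trees[of n] pmf_random_tree[OF assms]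
    by (subst measure_measure_pmf_finite) (auto simp: total_weight_def intro: sum.cong)
  also have "\<dots> = (\<Sum>T\<in>increasing_trees n. weight c1 c2 T * of_bool (P T)) / total_weight c1 c2 n"
    using finite_increasing_trees[of n]
    by (simp add: sum_divide_distrib of_bool_def if_distrib sum.If_cases Int_def cong: if_cong)
  finally show ?thesis .
qed

lemma family_alpha_pos: "very_simple_family c1 c2 \<Longrightarrow> family_alpha c1 c2 > 0"
  by (auto simp: very_simple_family_def)

text \<open>The number of large subtrees at depth \<open>h\<close> is the indicator of the event in question, so its
expectation is the probability.\<close>

lemma prob_centroid_depth_ge:
  fixes c1 c2 :: real
  assumes "very_simple_family c1 c2" "n \<ge> 1"
  defines "a \<equiv> family_alpha c1 c2"
  shows "measure_pmf.prob (random_tree c1 c2 n) {T. h \<le> centroid_depth T} =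
    a ^ h * chain_sum (scaled_weight a) (n div 2) h n / scaled_weight a n"
proof -
  have c1: "c1 > 0" using assms(1) by (simp add: very_simple_family_def)
  have a: "a > 0" using family_alpha_pos[OF assms(1)] by (simp add: a_def)
  have W: "total_weight c1 c2 n > 0" unfolding total_weight_def by (rule sum_weight_pos[OF assms(1,2)])
  have "large_subtrees (n div 2) h T = of_bool (h \<le> centroid_depth T)" if "T \<in> increasing_trees n" for T
    using large_subtrees_centroid_depth[of T h] that tree_size_increasing_trees[OF that]
    by (simp add: increasing_trees_def)
  then have "measure_pmf.prob (random_tree c1 c2 n) {T. h \<le> centroid_depth T} =
      total_large_subtrees c1 c2 (n div 2) h n / total_weight c1 c2 n"
    unfolding prob_random_tree[OF assms(1,2)] total_large_subtrees_def by simp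
  also have "\<dots> = a ^ h * chain_sum (scaled_weight a) (n div 2) h n / scaled_weight a n"
    using total_large_subtrees_eq[OF c1 assms(2), of c2 "n div 2" h] W scaled_weight_pos[OF a, of n]
    unfolding a_def[symmetric] by (simp add: field_simps)
  finally show ?thesis .
qed

lemma prob_centroid_depth_ge_tendsto:
  assumes "very_simple_family c1 c2"
  shows "(\<lambda>n. measure_pmf.prob (random_tree c1 c2 n) {T. h \<le> centroid_depth T})
    \<longlonglongrightarrow> tail_limit (family_alpha c1 c2) h"
proof (rule Lim_transform_eventually[OF chain_sum_scaled_weight_tendsto])
  show "\<forall>\<^sub>F n in sequentially. family_alpha c1 c2 ^ h * chain_sum (scaled_weight (family_alpha c1 c2)) (n div 2) h n /
      scaled_weight (family_alpha c1 c2) n = measure_pmf.prob (random_tree c1 c2 n) {T. h \<le> centroid_depth T}"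
    using eventually_ge_at_top[of 1] by eventually_elim (use prob_centroid_depth_ge[OF assms] in simp)
qed (rule family_alpha_pos[OF assms])

lemma prob_eq_diff_prob_ge:
  "measure_pmf.prob p {x. f x = (h::nat)} = measure_pmf.prob p {x. h \<le> f x} - measure_pmf.prob p {x. Suc h \<le> f x}"
proof -
  have eq: "{x. f x = h} = {x. h \<le> f x} - {x. Suc h \<le> f x}" by auto
  show ?thesis unfolding eq by (rule measure_pmf.finite_measure_Diff) auto
qed

text \<open>Only the convergence to zero needs attention: it makes the differences of \<open>t\<close> sum up to one.\<close>

lemma exists_pmf_with_tail:
  fixes t :: "nat \<Rightarrow> real"
  assumes "t 0 = 1" "decseq t" "t \<longlonglongrightarrow> 0"
  obtains D where "\<And>h. measure_pmf.prob D {x. x \<ge> h} = t h"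
proof
  let ?f = "\<lambda>h. t h - t (Suc h)"
  have nonneg: "?f h \<ge> 0" for h using decseq_SucD[OF assms(2), of h] by simp
  have sums: "?f sums 1" using telescope_sums'[OF assms(3)] assms(1) by simp
  have "(\<integral>\<^sup>+h. ennreal (?f h) \<partial>count_space UNIV) = 1"
    unfolding nn_integral_count_space_nat using suminf_ennreal_eq[OF nonneg sums] by simp
  then have pmf: "pmf (embed_pmf ?f) h = ?f h" for h
    using nonneg by (intro pmf_embed_pmf) auto
  show "measure_pmf.prob (embed_pmf ?f) {x. x \<ge> h} = t h" for h
  proof -
    have "{x. x \<ge> h} = - {..<h}" by auto
    then have "measure_pmf.prob (embed_pmf ?f) {x. x \<ge> h} = 1 - measure_pmf.prob (embed_pmf ?f) {..<h}"
      using measure_pmf.prob_compl[of "{..<h}" "embed_pmf ?f"] by (simp add: Compl_eq_Diff_UNIV)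
    also have "measure_pmf.prob (embed_pmf ?f) {..<h} = (\<Sum>j<h. ?f j)"
      by (subst measure_measure_pmf_finite) (simp_all add: pmf)
    also have "\<dots> = t 0 - t h" by (induction h) auto
    finally show ?thesis using assms(1) by simp
  qed
qed

text \<open>Reduces convergence in distribution of integer-valued variables to the convergence of the tail
probabilities.\<close>

lemma cdf_distr_nat:
  fixes f :: "'a \<Rightarrow> nat"
  shows "cdf (distr (measure_pmf p) borel (\<lambda>x. real (f x))) y =
    1 - measure_pmf.prob p {x. nat (\<lfloor>y\<rfloor> + 1) \<le> f x}"
proof -
  have "{x. real (f x) \<le> y} = - {x. nat (\<lfloor>y\<rfloor> + 1) \<le> f x}"
  proof (intro set_eqI)
    fix x
    have "real (f x) \<le> y \<longleftrightarrow> int (f x) \<le> \<lfloor>y\<rfloor>" by (simp add: le_floor_iff)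
    also have "\<dots> \<longleftrightarrow> \<not> nat (\<lfloor>y\<rfloor> + 1) \<le> f x" by linarith
    finally show "x \<in> {x. real (f x) \<le> y} \<longleftrightarrow> x \<in> - {x. nat (\<lfloor>y\<rfloor> + 1) \<le> f x}" by simp
  qed
  moreover have "cdf (distr (measure_pmf p) borel (\<lambda>x. real (f x))) y = measure_pmf.prob p {x. real (f x) \<le> y}"
    by (simp add: cdf_def measure_distr vimage_def)
  ultimately show ?thesis
    using measure_pmf.prob_compl[of "{x. nat (\<lfloor>y\<rfloor> + 1) \<le> f x}" p] by (simp add: Compl_eq_Diff_UNIV)
qed

theorem theorem6:
  fixes c1 c2 \<alpha> :: real
  assumes "very_simple_family c1 c2"
    and "\<alpha> = family_alpha c1 c2"
  shows "\<exists>\<D> :: nat pmf.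
    weak_conv_m
      (\<lambda>n. distr (measure_pmf (random_tree c1 c2 n)) borel (\<lambda>T. real (centroid_depth T)))
      (distr (measure_pmf \<D>) borel real) \<and>
    (\<forall>h. (\<lambda>n. measure_pmf.prob (random_tree c1 c2 n) {T. centroid_depth T = h})
           \<longlonglongrightarrow> measure_pmf.prob \<D> {x. x = h}) \<and>
    (\<forall>h. equals_or_limit_at_1 (measure_pmf.prob \<D> {x. x \<ge> h}) (\<lambda>a. depth_tail a h) \<alpha>) \<and>
    (\<forall>h. equals_or_limit_at_1 (measure_pmf.prob \<D> {x. x = h}) (\<lambda>a. depth_mass a h) \<alpha>)"
proof -
  let ?p = "random_tree c1 c2" and ?t = "tail_limit \<alpha>"
  have lim: "(\<lambda>n. measure_pmf.prob (?p n) {T. h \<le> centroid_depth T}) \<longlonglongrightarrow> ?t h" for h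
    unfolding assms(2) by (rule prob_centroid_depth_ge_tendsto[OF assms(1)])
  have "?t 0 = 1" by (simp add: tail_limit_def depth_tail_def)
  moreover have "decseq ?t"
  proof (rule decseq_SucI)
    show "?t (Suc h) \<le> ?t h" for h
      by (rule LIMSEQ_le[OF lim lim]) (auto intro!: exI[of _ 0] measure_pmf.finite_measure_mono)
  qed
  moreover have "?t \<longlonglongrightarrow> 0"
    using tail_limit_tendsto_0 family_alpha_pos[OF assms(1)] assms(2) by simp
  ultimately obtain D where D: "\<And>h. measure_pmf.prob D {x. x \<ge> h} = ?t h"
    using exists_pmf_with_tail by blast
  have mass: "measure_pmf.prob D {x. x = h} = ?t h - ?t (Suc h)" for h
    using prob_eq_diff_prob_ge[of D "\<lambda>x. x" h] D by simp
  have tail_at_1: "((\<lambda>a. depth_tail a h) \<longlongrightarrow> ?t h) (at 1)" if "\<alpha> = 1" for h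
    using depth_tail_tendsto_at_1 that by simp
  have "weak_conv_m (\<lambda>n. distr (measure_pmf (?p n)) borel (\<lambda>T. real (centroid_depth T)))
      (distr (measure_pmf D) borel real)"
    unfolding weak_conv_m_def weak_conv_def cdf_distr_nat cdf_distr_nat[where f = "\<lambda>x. x", simplified] D
    by (intro allI impI tendsto_intros lim)
  moreover have "(\<lambda>n. measure_pmf.prob (?p n) {T. centroid_depth T = h}) \<longlonglongrightarrow> measure_pmf.prob D {x. x = h}" for h
    unfolding mass unfolding prob_eq_diff_prob_ge by (intro tendsto_intros lim)
  moreover have "equals_or_limit_at_1 (measure_pmf.prob D {x. x \<ge> h}) (\<lambda>a. depth_tail a h) \<alpha>" for h
    unfolding equals_or_limit_at_1_def D using tail_at_1 by (simp add: tail_limit_def)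
  moreover have "equals_or_limit_at_1 (measure_pmf.prob D {x. x = h}) (\<lambda>a. depth_mass a h) \<alpha>" for h
  proof (cases "\<alpha> = 1")
    case True
    have "((\<lambda>a. depth_mass a h) \<longlongrightarrow> ?t h - ?t (Suc h)) (at 1)"
    proof (rule Lim_transform_eventually[OF tendsto_diff[OF tail_at_1 tail_at_1]])
      show "\<forall>\<^sub>F a in at 1. depth_tail a h - depth_tail a (Suc h) = depth_mass a h"
        using eventually_neq_at_within[of 1] by eventually_elim (simp add: depth_mass_eq)
    qed (use True in auto)
    then show ?thesis unfolding equals_or_limit_at_1_def mass using True by simp
  next
    case False
    then show ?thesis
      unfolding equals_or_limit_at_1_def mass by (simp add: tail_limit_def depth_mass_eq)
  qed
  ultimately show ?thesis by blast
qed

end
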